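(* Let $\mathbb{H}^+=\{\xi\in\mathbb{H}^n:\langle\xi,\nu\rangle>d\}$ be a half-space of the Heisenberg group $\mathbb{H}^n$, let $Q=2n+2$, let $2\le p<Q$ and let $p^*:=Qp/(Q-p)$. Then there exists a constant $C>0$, independent of $u$, such that for every $u\in C_0^\infty(\mathbb{H}^+)$, $$\left(\int_{\mathbb{H}^+}|\nabla_Hu|^p\,d\xi-\left(\frac{p-1}{p}\right)^p\int_{\mathbb{H}^+}\frac{\mathcal{W}(\xi)^p}{dist(\xi,\partial\mathbb{H}^+)^p}|u|^p\,d\xi\right)^{\frac1p}\;\geq\;C\left(\int_{\mathbb{H}^+}|u|^{p^*}\,d\xi\right)^{\frac{1}{p^*}}.$$
   Context: The Heisenberg group $\mathbb{H}^n$ is $\mathbb{R}^{2n+1}$ with points $\xi=(x,y,t)$, $x,y\in\mathbb{R}^n$, $t\in\mathbb{R}$, and group law $\xi\circ\widetilde\xi=\left(x+\widetilde x,\,y+\widetilde y,\,t+\widetilde t+2\sum_{i=1}^n(\widetilde x_iy_i-x_i\widetilde y_i)\right)$. Its left-invariant horizontal vector fields are $X_i=\frac{\partial}{\partial x_i}+2y_i\frac{\partial}{\partial t}$ and $Y_i=\frac{\partial}{\partial y_i}-2x_i\frac{\partial}{\partial t}$, $1\le i\le n$; the horizontal gradient is $\nabla_H=(X_1,\ldots,X_n,Y_1,\ldots,Y_n)$. $d\xi$ is Lebesgue measure on $\mathbb{R}^{2n+1}$ and $|\cdot|$ the Euclidean norm. $Q=2n+2$ is the homogeneous dimension of $\mathbb{H}^n$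 with respect to the dilations $\delta_\lambda(\xi)=(\lambda x,\lambda y,\lambda^2t)$. A half-space is $\mathbb{H}^+=\{\xi\in\mathbb{H}^n:\langle\xi,\nu\rangle>d\}$, where $d\in\mathbb{R}$, $\nu=(\nu_x,\nu_y,\nu_t)$ with $\nu_x,\nu_y\in\mathbb{R}^n$, $\nu_t\in\mathbb{R}$ is the unit normal to the boundary $\partial\mathbb{H}^+$ (a unit vector of $\mathbb{R}^{2n+1}$), and $\langle\cdot,\cdot\rangle$ is the Euclidean inner product on $\mathbb{R}^{2n+1}$. The distance to the boundary is $dist(\xi,\partial\mathbb{H}^+)=\langle\xi,\nu\rangle-d$. Writing $X_i(\xi),Y_i(\xi)\in\mathbb{R}^{2n+1}$ for the coefficient vectors of $X_i,Y_i$ at $\xi$, so that $\langle X_i(\xi),\nu\rangle=\nu_{x,i}+2y_i\nu_t$ and $\langle Y_i(\xi),\nu\rangle=\nu_{y,i}-2x_i\nu_t$, the angle function is $\mathcal{W}(\xi)=\left(\sum_{i=1}^n\langle X_i(\xi),\nu\rangle^2+\langle Y_i(\xi),\nu\rangle^2\right)^{1/2}$. *)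

theory Defs
  imports "HOL-Analysis.Analysis"
begin

text \<open>
  Points are triples \<open>(x, y, t)\<close>. The norm, inner product and \<open>lborel\<close> of the product
  type are the Euclidean ones of dimension \<open>2n + 1\<close>, where \<open>n = CARD('n)\<close>.
\<close>

type_synonym 'n heisenberg = "(real^'n) \<times> (real^'n) \<times> real"

text \<open>Coefficient vectors of \<open>\<partial>/\<partial>x\<^sub>i + 2 y\<^sub>i \<partial>/\<partial>t\<close> and \<open>\<partial>/\<partial>y\<^sub>i - 2 x\<^sub>i \<partial>/\<partial>t\<close>.\<close>

definition X_field :: "'n::finite \<Rightarrow> 'n heisenberg \<Rightarrow> 'n heisenberg" where
  "X_field i = (\<lambda>(x, y, t). (axis i 1, 0, 2 * y $ i))"

definition Y_field :: "'n::finite \<Rightarrow> 'n heisenberg \<Rightarrow> 'n heisenberg" where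
  "Y_field i = (\<lambda>(x, y, t). (0, axis i 1, - 2 * x $ i))"

definition horizontal_gradient ::
  "('n::finite heisenberg \<Rightarrow> real) \<Rightarrow> 'n heisenberg \<Rightarrow> (real^'n) \<times> (real^'n)" where
  "horizontal_gradient u \<xi> =
     (\<chi> i. frechet_derivative u (at \<xi>) (X_field i \<xi>),
      \<chi> i. frechet_derivative u (at \<xi>) (Y_field i \<xi>))"

lemma horizontal_gradient_eq_partials:
  fixes u :: "'n::finite heisenberg \<Rightarrow> real"
  assumes "u differentiable (at (x, y, t))"
  defines "D \<equiv> frechet_derivative u (at (x, y, t))"
  shows "horizontal_gradient u (x, y, t) =
     (\<chi> i. D (axis i 1, 0, 0) + 2 * y $ i * D (0, 0, 1),
      \<chi> i. D (0, axis i 1, 0) - 2 * x $ i * D (0, 0, 1))"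
proof -
  interpret linear D
    unfolding D_def using assms(1) by (rule linear_frechet_derivative)
  have "D (axis i 1, 0, 2 * y $ i) = D (axis i 1, 0, 0) + 2 * y $ i * D (0, 0, 1)" for i
    using add[of "(axis i 1, 0, 0)" "(2 * y $ i) *\<^sub>R (0, 0, 1)"] scaleR[of "2 * y $ i" "(0, 0, 1)"]
    by simp
  moreover have "D (0, axis i 1, - 2 * x $ i) = D (0, axis i 1, 0) - 2 * x $ i * D (0, 0, 1)" for i
    using add[of "(0, axis i 1, 0)" "(- 2 * x $ i) *\<^sub>R (0, 0, 1)"]
      scaleR[of "- 2 * x $ i" "(0, 0, 1)"]
    by simp
  ultimately show ?thesis
    by (simp add: horizontal_gradient_def X_field_def Y_field_def flip: D_def)
qed

definition half_space :: "'n::finite heisenberg \<Rightarrow> real \<Rightarrow> 'n heisenberg set" where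
  "half_space \<nu> d = {\<xi>. \<xi> \<bullet> \<nu> > d}"

text \<open>Distance to the boundary of \<open>half_space \<nu> d\<close>, for unit \<open>\<nu>\<close> and \<open>\<xi>\<close> in the half-space.\<close>

definition boundary_dist :: "'n::finite heisenberg \<Rightarrow> real \<Rightarrow> 'n heisenberg \<Rightarrow> real" where
  "boundary_dist \<nu> d \<xi> = \<xi> \<bullet> \<nu> - d"

definition angle_function :: "'n::finite heisenberg \<Rightarrow> 'n heisenberg \<Rightarrow> real" where
  "angle_function \<nu> \<xi> = sqrt (\<Sum>i\<in>UNIV. (X_field i \<xi> \<bullet> \<nu>)\<^sup>2 + (Y_field i \<xi> \<bullet> \<nu>)\<^sup>2)"

text \<open>\<open>C_k k f\<close>: \<open>f\<close> is \<open>k\<close> times continuously differentiable on the whole space.\<close>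

primrec C_k :: "nat \<Rightarrow> ('a::euclidean_space \<Rightarrow> real) \<Rightarrow> bool" where
  "C_k 0 f \<longleftrightarrow> continuous_on UNIV f"
| "C_k (Suc k) f \<longleftrightarrow>
     (\<forall>x. f differentiable (at x)) \<and> (\<forall>v. C_k k (\<lambda>x. frechet_derivative f (at x) v))"

text \<open>
  \<open>C\<^sub>0\<^sup>\<infinity>(U)\<close> for open \<open>U\<close>. Its elements are represented by their extension by zero
  to the whole space.
\<close>

definition test_functions :: "'a::euclidean_space set \<Rightarrow> ('a \<Rightarrow> real) set" where
  "test_functions U =
     {u. (\<forall>k. C_k k u) \<and> compact (closure {x. u x \<noteq> 0}) \<and> closure {x. u x \<noteq> 0} \<subseteq> U}"

end

theory Submission
  imports Defs
begin

text \<open>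
  Let \<open>D\<close> be the distance to the boundary, \<open>N = \<nabla>\<^sub>H D\<close>, so that \<open>\<bar>N\<bar> = W\<close>, and
  \<open>B = \<nabla>\<^sub>H u - ((p - 1) / p) (u / D) N\<close>. The vector field \<open>Z = \<Sum> N\<^sub>i X\<^sub>i\<close> is divergence free and
  satisfies \<open>Z D = W\<^sup>2\<close> and \<open>Z W = 0\<close>, so that \<open>\<integral> a(W) Z h = 0\<close> for every \<open>h\<close> of compact support.
  With \<open>a = W\<^sup>p\<^sup>-\<^sup>2\<close> and \<open>h = \<bar>u\<bar>\<^sup>p D\<^sup>1\<^sup>-\<^sup>p\<close> the cross term in the expansion of
  \<open>\<bar>((p - 1) / p) (u / D) N + B\<bar>\<^sup>p\<close> drops out, and the Hardy difference is at least
  \<open>2\<^sup>1\<^sup>-\<^sup>p \<integral> \<bar>B\<bar>\<^sup>p\<close>. With \<open>a = 1 / W\<close> and \<open>h = \<bar>u\<bar>\<^sup>q\<close>, \<open>q = p (Q - 1) / (Q - p)\<close>, one gets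
  \<open>\<integral> \<bar>\<nabla>\<^sub>H \<bar>u\<bar>\<^sup>q\<bar> \<le> 2 q \<integral> \<bar>u\<bar>\<^sup>q\<^sup>-\<^sup>1 \<bar>B\<bar>\<close>, and Hoelder's inequality together with the \<open>L\<^sup>1\<close> Sobolev inequality
  for \<open>\<bar>u\<bar>\<^sup>q\<close> concludes. The latter follows from the pseudo-Poincare inequality for right translations
  by a box of measure comparable to \<open>r\<^sup>Q\<close>, applied to dyadic truncations.
\<close>

section \<open>Horizontal fields and pseudo-Poincare inequality\<close>

text \<open>Inside the half-space \<open>B = D^k \<nabla>\<^sub>H (u / D^k)\<close> with
  \<open>k = (p - 1) / p\<close>. The Hardy remainder thus controls only a gradient weighted by a
  power of \<open>D\<close>, a weight that degenerates at the boundary, and an unweighted Sobolev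
  inequality does not apply to \<open>u / D^k\<close>. The way out is to look at
  \<open>\<bar>u\<bar>^q\<close> instead: the part of its gradient that \<open>B\<close> misses has
  integral \<open>q k \<integral> \<bar>u\<bar>^q W / D\<close>, and this is the very quantity
  produced by testing \<open>Z\<close> against \<open>\<bar>u\<bar>^q\<close> with weight
  \<open>1 / W\<close>, where the only other term contains \<open>B\<close>.

  Two facts about \<open>Z\<close> carry this. Each coordinate of \<open>Z\<close> is independent of
  the variable in whose direction it points, so the divergence vanishes term by term. The derivative
  of \<open>N\<close> is \<open>2 \<nu>\<^sub>t\<close> times a quarter turn, so along
  \<open>Z\<close> the vector \<open>N\<close> turns without changing its length \<open>W\<close>.

  The zeros of \<open>W\<close> are the obstacle: \<open>W^(p-2)\<close> is harmless there because
  \<open>p \<ge> 2\<close>, but \<open>1 / W\<close> is singular. Both weights are therefore reached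
  through powers of \<open>W^2 + e\<close>.\<close>

definition hfield :: "(real^'n) \<times> (real^'n) \<Rightarrow> 'n::finite heisenberg \<Rightarrow> 'n heisenberg" where
  "hfield w \<xi> = (fst w, snd w, 2 * (fst w \<bullet> fst (snd \<xi>) - fst \<xi> \<bullet> snd w))"

lemma hfield_eq_sum:
  fixes w :: "(real^'n::finite) \<times> (real^'n)"
  shows "hfield w \<xi> = (\<Sum>i\<in>UNIV. (fst w $ i) *\<^sub>R X_field i \<xi>) + (\<Sum>i\<in>UNIV. (snd w $ i) *\<^sub>R Y_field i \<xi>)"
proof -
  have "(\<Sum>i\<in>UNIV. (v $ i) *\<^sub>R axis i 1) = v" for v :: "real^'n"
    using basis_expansion[of v] by (simp add: scalar_mult_eq_scaleR)
  then show ?thesis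
    by (simp add: hfield_def X_field_def Y_field_def prod_eq_iff fst_sum snd_sum inner_vec_def
        sum_distrib_left algebra_simps case_prod_beta flip: sum.distrib sum_subtractf sum_negf)
qed

lemma frechet_derivative_hfield:
  assumes "f differentiable (at \<xi>)"
  shows "frechet_derivative f (at \<xi>) (hfield w \<xi>) = horizontal_gradient f \<xi> \<bullet> w"
proof -
  interpret linear "frechet_derivative f (at \<xi>)"
    using assms by (rule linear_frechet_derivative)
  show ?thesis
    by (simp add: hfield_eq_sum add sum scaleR horizontal_gradient_def inner_prod_def inner_vec_def
        mult.commute)
qed

text \<open>Moving along \<open>hfield w\<close> is right translation by \<open>(w, 0)\<close>, hence follows straight lines.\<close>

lemma hfield_along: "hfield w (\<xi> + s *\<^sub>R hfield w \<xi>) = hfield w \<xi>"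
  by (simp add: hfield_def inner_simps inner_commute algebra_simps)

lemma hfield_scaleR: "hfield (s *\<^sub>R w) \<xi> = s *\<^sub>R hfield w \<xi>"
  by (simp add: hfield_def algebra_simps)

lemma continuous_on_hfield [continuous_intros]:
  "continuous_on S w \<Longrightarrow> continuous_on S g \<Longrightarrow> continuous_on S (\<lambda>x. hfield (w x) (g x))"
  unfolding hfield_def by (intro continuous_intros)

section \<open>Invariance of Lebesgue measure under shears and horizontal moves\<close>

lemma nn_integral_lborel_translate:
  fixes c :: "'a::euclidean_space"
  assumes [measurable]: "f \<in> borel_measurable borel"
  shows "(\<integral>\<^sup>+x. f (x + c) \<partial>lborel) = (\<integral>\<^sup>+x. f x \<partial>lborel)"
proof -
  have "(\<integral>\<^sup>+x. f x \<partial>lborel) = (\<integral>\<^sup>+x. f x \<partial>(distr lborel borel ((+) c)))"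
    by (simp add: lborel_distr_plus)
  also have "\<dots> = (\<integral>\<^sup>+x. f (x + c) \<partial>lborel)"
    by (subst nn_integral_distr) (auto simp: add.commute)
  finally show ?thesis by simp
qed

lemma nn_integral_lborel_Pair:
  fixes f :: "'a::euclidean_space \<times> 'b::euclidean_space \<Rightarrow> ennreal"
  assumes "f \<in> borel_measurable borel"
  shows "(\<integral>\<^sup>+z. f z \<partial>lborel) = (\<integral>\<^sup>+x. \<integral>\<^sup>+y. f (x, y) \<partial>lborel \<partial>lborel)"
proof -
  have "f \<in> borel_measurable (lborel \<Otimes>\<^sub>M lborel)"
    using assms by (simp add: lborel_prod)
  from lborel.nn_integral_fst[OF this] show ?thesis by (simp add: lborel_prod)
qed

lemma borel_measurable_Pair1:
  fixes f :: "'a::euclidean_space \<times> 'b::euclidean_space \<Rightarrow> ennreal"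
  assumes "f \<in> borel_measurable borel"
  shows "(\<lambda>y. f (x, y)) \<in> borel_measurable borel"
  by (rule measurable_compose[OF _ assms]) (intro borel_measurable_continuous_onI continuous_intros)

text \<open>Fubini with \<open>t\<close> innermost: there \<open>\<psi> x y\<close> is a constant
  and disappears by translation invariance. The shifts by \<open>b\<close> and \<open>a\<close> then
  disappear in the two outer integrals.\<close>

lemma nn_integral_lborel_shear:
  fixes F :: "'n::finite heisenberg \<Rightarrow> ennreal" and \<psi> :: "real^'n \<Rightarrow> real^'n \<Rightarrow> real"
  assumes F: "F \<in> borel_measurable borel"
    and \<psi>: "continuous_on UNIV (\<lambda>z. \<psi> (fst z) (snd z))"
  shows "(\<integral>\<^sup>+\<xi>. F (fst \<xi> + a, fst (snd \<xi>) + b, snd (snd \<xi>) + \<psi> (fst \<xi>) (fst (snd \<xi>))) \<partial>lborel)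
    = (\<integral>\<^sup>+\<xi>. F \<xi> \<partial>lborel)" (is "?L = _")
proof -
  let ?G = "\<lambda>\<xi>. F (fst \<xi> + a, fst (snd \<xi>) + b, snd (snd \<xi>) + \<psi> (fst \<xi>) (fst (snd \<xi>)))"
  have cont: "continuous_on UNIV (\<lambda>\<xi>::'n heisenberg. \<psi> (fst \<xi>) (fst (snd \<xi>)))"
    by (rule continuous_on_compose2[OF \<psi>, of UNIV "\<lambda>\<xi>. (fst \<xi>, fst (snd \<xi>))", simplified])
      (intro continuous_intros)
  have G: "?G \<in> borel_measurable borel"
    by (rule measurable_compose[OF _ F])
      (intro borel_measurable_continuous_onI continuous_intros cont)
  have Gm: "(\<lambda>z. ?G (x, z)) \<in> borel_measurable borel" for x
    by (rule borel_measurable_Pair1[OF G])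
  have Fm: "(\<lambda>z. F (x, z)) \<in> borel_measurable borel" for x
    by (rule borel_measurable_Pair1[OF F])
  have Fm2: "(\<lambda>t. F (x, y, t)) \<in> borel_measurable borel" for x y
    by (rule borel_measurable_Pair1[OF Fm])
  have Im: "(\<lambda>y. \<integral>\<^sup>+t. F (x, y, t) \<partial>lborel) \<in> borel_measurable borel" for x
    using lborel.borel_measurable_nn_integral_fst[of "\<lambda>z. F (x, z)" lborel] Fm[of x]
    by (simp add: lborel_prod)
  have Im2: "(\<lambda>x. \<integral>\<^sup>+z. F (x, z) \<partial>lborel) \<in> borel_measurable borel"
    using lborel.borel_measurable_nn_integral_fst[of F lborel] F
    by (simp add: lborel_prod)
  have "?L = (\<integral>\<^sup>+x. \<integral>\<^sup>+y. \<integral>\<^sup>+t. ?G (x, y, t) \<partial>lborel \<partial>lborel \<partial>lborel)"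
    by (subst nn_integral_lborel_Pair[OF G], subst nn_integral_lborel_Pair[OF Gm]) (rule refl)
  also have "\<dots> = (\<integral>\<^sup>+x. \<integral>\<^sup>+y. \<integral>\<^sup>+t. F (x + a, y + b, t) \<partial>lborel \<partial>lborel \<partial>lborel)"
    using nn_integral_lborel_translate[OF Fm2] by simp
  also have "\<dots> = (\<integral>\<^sup>+x. \<integral>\<^sup>+y. \<integral>\<^sup>+t. F (x + a, y, t) \<partial>lborel \<partial>lborel \<partial>lborel)"
    using nn_integral_lborel_translate[OF Im] by simp
  also have "\<dots> = (\<integral>\<^sup>+x. \<integral>\<^sup>+z. F (x + a, z) \<partial>lborel \<partial>lborel)"
    by (subst nn_integral_lborel_Pair[OF Fm]) (rule refl)
  also have "\<dots> = (\<integral>\<^sup>+x. \<integral>\<^sup>+z. F (x, z) \<partial>lborel \<partial>lborel)"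
    using nn_integral_lborel_translate[OF Im2] by simp
  also have "\<dots> = (\<integral>\<^sup>+\<xi>. F \<xi> \<partial>lborel)"
    by (subst nn_integral_lborel_Pair[OF F]) (rule refl)
  finally show ?thesis .
qed

lemma nn_integral_lborel_hfield:
  fixes F :: "'n::finite heisenberg \<Rightarrow> ennreal"
  assumes "F \<in> borel_measurable borel"
  shows "(\<integral>\<^sup>+\<xi>. F (\<xi> + hfield w \<xi>) \<partial>lborel) = (\<integral>\<^sup>+\<xi>. F \<xi> \<partial>lborel)"
proof -
  have "\<xi> + hfield w \<xi> = (fst \<xi> + fst w, fst (snd \<xi>) + snd w, snd (snd \<xi>) + 2 * (fst w \<bullet> fst (snd \<xi>) - fst \<xi> \<bullet> snd w))" for \<xi> :: "'n heisenberg"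
    by (simp add: hfield_def prod_eq_iff)
  then show ?thesis
    using nn_integral_lborel_shear[OF assms, of "\<lambda>x y. 2 * (fst w \<bullet> y - x \<bullet> snd w)" "fst w" "snd w"]
    by (simp add: continuous_intros)
qed

text \<open>Vanishing outside some compact set, rather than a condition on the closure of the
  support, passes without any computation to products, to derivatives and to compositions that fix
  0: the same \<open>K\<close> serves throughout.\<close>

definition C1c :: "('a::euclidean_space \<Rightarrow> real) \<Rightarrow> bool" where
  "C1c f \<longleftrightarrow> C_k (Suc 0) f \<and> (\<exists>K. compact K \<and> (\<forall>x. x \<notin> K \<longrightarrow> f x = 0))"

lemma C1c_differentiable: "C1c f \<Longrightarrow> f differentiable (at x)"
  by (simp add: C1c_def)

lemma C1c_has_derivative: "C1c f \<Longrightarrow> (f has_derivative frechet_derivative f (at x)) (at x)"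
  using C1c_differentiable frechet_derivative_works by blast

lemma C1c_continuous_on: "C1c f \<Longrightarrow> continuous_on S f"
  by (meson C1c_differentiable continuous_at_imp_continuous_on differentiable_imp_continuous_within)

lemma C1c_continuous_derivative: "C1c f \<Longrightarrow> continuous_on S (\<lambda>x. frechet_derivative f (at x) v)"
  by (auto simp: C1c_def intro: continuous_on_subset)

lemma frechet_derivative_zero_outside:
  fixes f :: "'a::euclidean_space \<Rightarrow> real"
  assumes "closed K" "\<And>x. x \<notin> K \<Longrightarrow> f x = 0" "x \<notin> K"
  shows "(f has_derivative (\<lambda>_. 0)) (at x)" "frechet_derivative f (at x) = (\<lambda>_. 0)"
proof -
  have "((\<lambda>_. 0) has_derivative (\<lambda>_. 0)) (at x)" by simp
  then show "(f has_derivative (\<lambda>_. 0)) (at x)"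
    by (rule has_derivative_transform_within_open[of _ _ _ UNIV "- K"]) (use assms in auto)
  then show "frechet_derivative f (at x) = (\<lambda>_. 0)"
    using frechet_derivative_at by metis
qed

text \<open>Continuity is asked only on a set \<open>U\<close> around \<open>K\<close>, since
  quotients by the boundary distance are continuous only inside the half-space.\<close>

lemma integrable_continuous_compact_support:
  fixes f :: "'a::euclidean_space \<Rightarrow> real"
  assumes "compact K" "K \<subseteq> U" "continuous_on U f" "\<And>x. x \<notin> K \<Longrightarrow> f x = 0"
  shows "integrable lborel f"
proof -
  have "integrable lborel (\<lambda>x. indicator K x *\<^sub>R f x)"
    using borel_integrable_compact[of K f] assms continuous_on_subset by blast
  moreover have "(\<lambda>x. indicator K x *\<^sub>R f x) = f"
    using assms by (auto simp: indicator_def fun_eq_iff)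
  ultimately show ?thesis by simp
qed

text \<open>\<open>C1c\<close> gives continuity of the derivative in each fixed direction, whereas
  \<open>X_field i \<xi>\<close> moves with \<open>\<xi>\<close>. Expanding in partial derivatives
  separates the two dependences.\<close>

lemma continuous_on_horizontal_gradient:
  assumes "C1c f"
  shows "continuous_on S (horizontal_gradient f)"
proof -
  have eq: "horizontal_gradient f = (\<lambda>\<xi>.
     (\<chi> i. frechet_derivative f (at \<xi>) (axis i 1, 0, 0) + 2 * fst (snd \<xi>) $ i * frechet_derivative f (at \<xi>) (0, 0, 1),
      \<chi> i. frechet_derivative f (at \<xi>) (0, axis i 1, 0) - 2 * fst \<xi> $ i * frechet_derivative f (at \<xi>) (0, 0, 1)))"
    using horizontal_gradient_eq_partials[OF C1c_differentiable[OF assms]] by auto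
  show ?thesis unfolding eq
    by (intro continuous_intros C1c_continuous_derivative[OF assms])
qed

lemma horizontal_gradient_zero_outside:
  assumes "closed K" "\<And>x. x \<notin> K \<Longrightarrow> f x = 0" "x \<notin> K"
  shows "horizontal_gradient f x = 0"
  using frechet_derivative_zero_outside(2)[OF assms]
  by (simp add: horizontal_gradient_def prod_eq_iff vec_eq_iff)

text \<open>The increment is the integral of \<open>horizontal_gradient f \<bullet> w\<close> along
  a straight segment. After exchanging the integrals, the one over \<open>\<xi>\<close> at a fixed
  time \<open>s\<close> involves the horizontal move by \<open>s *\<^sub>R w\<close>, which
  preserves the measure, so every \<open>s\<close> contributes the same amount.\<close>

lemma nn_integral_horizontal_segment_le:
  fixes f :: "'n::finite heisenberg \<Rightarrow> real"
  assumes f: "C1c f"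
  shows "(\<integral>\<^sup>+\<xi>. ennreal \<bar>f (\<xi> + hfield w \<xi>) - f \<xi>\<bar> \<partial>lborel)
    \<le> ennreal (norm w) * (\<integral>\<^sup>+\<xi>. ennreal (norm (horizontal_gradient f \<xi>)) \<partial>lborel)"
proof -
  let ?g = "\<lambda>\<xi>. norm w * norm (horizontal_gradient f \<xi>)"
  have gc: "continuous_on S ?g" for S
    by (intro continuous_intros continuous_on_horizontal_gradient f)
  have gm: "(\<lambda>\<xi>. ennreal (?g \<xi>)) \<in> borel_measurable borel"
    using borel_measurable_continuous_onI[OF gc] by simp
  have pt: "ennreal \<bar>f (\<xi> + hfield w \<xi>) - f \<xi>\<bar>
      \<le> (\<integral>\<^sup>+s. indicator {0..1} s * ennreal (?g (\<xi> + s *\<^sub>R hfield w \<xi>)) \<partial>lborel)" for \<xi>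
  proof -
    let ?p = "\<lambda>s. \<xi> + s *\<^sub>R hfield w \<xi>"
    have der: "((\<lambda>s. f (?p s)) has_real_derivative horizontal_gradient f (?p s) \<bullet> w) (at s within S)" for s S
    proof -
      have "((\<lambda>s. f (?p s)) has_derivative (\<lambda>h. frechet_derivative f (at (?p s)) (h *\<^sub>R hfield w \<xi>))) (at s within S)"
        by (rule has_derivative_compose[OF _ C1c_has_derivative[OF f]]) (auto intro!: derivative_eq_intros)
      moreover have "frechet_derivative f (at (?p s)) (h *\<^sub>R hfield w \<xi>) = (horizontal_gradient f (?p s) \<bullet> w) * h" for h
        using frechet_derivative_hfield[OF C1c_differentiable[OF f], of "?p s" w] hfield_along[of w \<xi> s]
        by (simp add: linear_cmul[OF linear_frechet_derivative[OF C1c_differentiable[OF f]]] mult.commute)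
      ultimately show ?thesis
        by (simp add: has_field_derivative_def)
    qed
    have "((\<lambda>s. horizontal_gradient f (?p s) \<bullet> w) has_integral f (?p 1) - f (?p 0)) {0..1}"
      by (rule fundamental_theorem_of_calculus)
        (use der in \<open>auto simp: has_real_derivative_iff_has_vector_derivative\<close>)
    then have hi: "((\<lambda>s. horizontal_gradient f (?p s) \<bullet> w) has_integral f (?p 1) - f \<xi>) {0..1}"
      by simp
    have pc: "continuous_on {0..1} ?p" by (intro continuous_intros)
    have ii: "(\<lambda>s. ?g (?p s)) integrable_on {0..1}"
      by (intro integrable_continuous_real continuous_on_compose2[OF gc pc]) auto
    then have ic: "((\<lambda>s. ?g (?p s)) has_integral integral {0..1} (\<lambda>s. ?g (?p s))) {0..1}"
      by (rule integrable_integral)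
    have "norm (integral {0..1} (\<lambda>s. horizontal_gradient f (?p s) \<bullet> w)) \<le> integral {0..1} (\<lambda>s. ?g (?p s))"
      using hi ii by (intro integral_norm_bound_integral)
        (auto simp: mult.commute[of "norm w"] Cauchy_Schwarz_ineq2)
    then have "\<bar>f (\<xi> + hfield w \<xi>) - f \<xi>\<bar> \<le> integral {0..1} (\<lambda>s. ?g (?p s))"
      using integral_unique[OF hi] by simp
    moreover have "(\<integral>\<^sup>+s. ennreal (?g (?p s)) * indicator {0..1} s \<partial>lborel) = ennreal (integral {0..1} (\<lambda>s. ?g (?p s)))"
      by (rule nn_integral_has_integral_lebesgue'[OF _ ic]) auto
    ultimately show ?thesis
      by (simp add: ennreal_leI mult.commute)
  qed
  have hm: "(\<lambda>(\<xi>, s). indicator {0..1} s * ennreal (?g (\<xi> + s *\<^sub>R hfield w \<xi>))) \<in> borel_measurable (lborel \<Otimes>\<^sub>M lborel)"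
  proof -
    have "continuous_on UNIV (\<lambda>z. ?g (fst z + snd z *\<^sub>R hfield w (fst z)))"
      by (rule continuous_on_compose2[OF gc, of UNIV]) (auto intro!: continuous_intros)
    then have [measurable]: "(\<lambda>z. ?g (fst z + snd z *\<^sub>R hfield w (fst z))) \<in> borel_measurable borel"
      by (rule borel_measurable_continuous_onI)
    have [measurable]: "(snd :: 'n heisenberg \<times> real \<Rightarrow> real) \<in> borel_measurable borel"
      by (intro borel_measurable_continuous_onI continuous_intros)
    have "(\<lambda>z. indicator {0..1} (snd z) * ennreal (?g (fst z + snd z *\<^sub>R hfield w (fst z)))) \<in> borel_measurable (borel :: ('n heisenberg \<times> real) measure)"
      by measurable
    then show ?thesis by (simp add: lborel_prod case_prod_beta)
  qed
  have "(\<integral>\<^sup>+\<xi>. ennreal \<bar>f (\<xi> + hfield w \<xi>) - f \<xi>\<bar> \<partial>lborel)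
    \<le> (\<integral>\<^sup>+\<xi>. \<integral>\<^sup>+s. indicator {0..1} s * ennreal (?g (\<xi> + s *\<^sub>R hfield w \<xi>)) \<partial>lborel \<partial>lborel)"
    by (intro nn_integral_mono pt)
  also have "\<dots> = (\<integral>\<^sup>+s. \<integral>\<^sup>+\<xi>. indicator {0..1} s * ennreal (?g (\<xi> + s *\<^sub>R hfield w \<xi>)) \<partial>lborel \<partial>lborel)"
    by (rule lborel_pair.Fubini'[OF hm, symmetric])
  also have "\<dots> = (\<integral>\<^sup>+s. indicator {0..1} (s::real) * (\<integral>\<^sup>+\<xi>. ennreal (?g \<xi>) \<partial>lborel) \<partial>lborel)"
  proof (rule nn_integral_cong)
    fix s :: real
    have "(\<lambda>\<xi>. ennreal (?g (\<xi> + hfield (s *\<^sub>R w) \<xi>))) \<in> borel_measurable borel"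
      by (intro measurable_compose[OF _ gm] borel_measurable_continuous_onI continuous_intros)
    then show "(\<integral>\<^sup>+\<xi>. indicator {0..1} s * ennreal (?g (\<xi> + s *\<^sub>R hfield w \<xi>)) \<partial>lborel) =
      indicator {0..1} s * (\<integral>\<^sup>+\<xi>. ennreal (?g \<xi>) \<partial>lborel)"
      using nn_integral_lborel_hfield[OF gm, of "s *\<^sub>R w"] 
      by (simp add: nn_integral_cmult hfield_scaleR)
  qed
  also have "\<dots> = (\<integral>\<^sup>+\<xi>. ennreal (?g \<xi>) \<partial>lborel)"
    by (subst nn_integral_multc) auto
  also have "\<dots> = ennreal (norm w) * (\<integral>\<^sup>+\<xi>. ennreal (norm (horizontal_gradient f \<xi>)) \<partial>lborel)"
    using borel_measurable_continuous_onI[OF continuous_on_horizontal_gradient[OF f]]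
    by (simp add: ennreal_mult nn_integral_cmult)
  finally show ?thesis .
qed

text \<open>Triangle inequality over the vertices. The later edges start from an already moved
  point, which changes nothing after integration because each move preserves the measure.\<close>

lemma nn_integral_horizontal_polygon_le:
  fixes f :: "'n::finite heisenberg \<Rightarrow> real"
  assumes f: "C1c f"
  shows "(\<integral>\<^sup>+\<xi>. ennreal \<bar>f (fold (\<lambda>w \<xi>. \<xi> + hfield w \<xi>) ws \<xi>) - f \<xi>\<bar> \<partial>lborel)
    \<le> ennreal (sum_list (map norm ws)) * (\<integral>\<^sup>+\<xi>. ennreal (norm (horizontal_gradient f \<xi>)) \<partial>lborel)"
proof (induction ws)
  case (Cons w ws)
  let ?G = "fold (\<lambda>w \<xi>. \<xi> + hfield w \<xi>) ws"
  let ?t = "\<lambda>\<xi>. \<xi> + hfield w \<xi>"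
  have tc: "continuous_on UNIV ?t" by (intro continuous_intros)
  have Gc: "continuous_on UNIV ?G"
  proof (induction ws)
    case (Cons a ws)
    have "continuous_on UNIV (\<lambda>\<xi>. fold (\<lambda>w \<xi>. \<xi> + hfield w \<xi>) ws (\<xi> + hfield a \<xi>))"
      by (rule continuous_on_compose2[OF Cons]) (auto intro!: continuous_intros)
    then show ?case by (simp add: comp_def)
  qed (simp add: continuous_on_id)
  have m1: "(\<lambda>\<xi>. ennreal \<bar>f (?G \<xi>) - f \<xi>\<bar>) \<in> borel_measurable borel"
  proof -
    have "continuous_on UNIV (\<lambda>\<xi>. \<bar>f (?G \<xi>) - f \<xi>\<bar>)"
      by (intro continuous_intros C1c_continuous_on[OF f] continuous_on_compose2[OF C1c_continuous_on[OF f] Gc]) auto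
    then show ?thesis using borel_measurable_continuous_onI by force
  qed
  have m2: "(\<lambda>\<xi>. ennreal \<bar>f (?G (?t \<xi>)) - f (?t \<xi>)\<bar>) \<in> borel_measurable borel"
    by (rule measurable_compose[OF _ m1]) (rule borel_measurable_continuous_onI[OF tc])
  have m3: "(\<lambda>\<xi>. ennreal \<bar>f (?t \<xi>) - f \<xi>\<bar>) \<in> borel_measurable borel"
  proof -
    have "continuous_on UNIV (\<lambda>\<xi>. \<bar>f (?t \<xi>) - f \<xi>\<bar>)"
      by (intro continuous_intros C1c_continuous_on[OF f] continuous_on_compose2[OF C1c_continuous_on[OF f] tc]) auto
    then show ?thesis using borel_measurable_continuous_onI by force
  qed
  have "(\<integral>\<^sup>+\<xi>. ennreal \<bar>f (?G (?t \<xi>)) - f \<xi>\<bar> \<partial>lborel)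
    \<le> (\<integral>\<^sup>+\<xi>. ennreal \<bar>f (?G (?t \<xi>)) - f (?t \<xi>)\<bar> + ennreal \<bar>f (?t \<xi>) - f \<xi>\<bar> \<partial>lborel)"
    by (intro nn_integral_mono) (simp flip: ennreal_plus)
  also have "\<dots> = (\<integral>\<^sup>+\<xi>. ennreal \<bar>f (?G (?t \<xi>)) - f (?t \<xi>)\<bar> \<partial>lborel) + (\<integral>\<^sup>+\<xi>. ennreal \<bar>f (?t \<xi>) - f \<xi>\<bar> \<partial>lborel)"
    using m2 m3 by (intro nn_integral_add) auto
  also have "\<dots> \<le> (\<integral>\<^sup>+\<xi>. ennreal \<bar>f (?G \<xi>) - f \<xi>\<bar> \<partial>lborel)
      + ennreal (norm w) * (\<integral>\<^sup>+\<xi>. ennreal (norm (horizontal_gradient f \<xi>)) \<partial>lborel)"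
    using nn_integral_lborel_hfield[OF m1, of w] nn_integral_horizontal_segment_le[OF f, of w] by (simp add: add_mono)
  also have "\<dots> \<le> ennreal (sum_list (map norm (w # ws))) * (\<integral>\<^sup>+\<xi>. ennreal (norm (horizontal_gradient f \<xi>)) \<partial>lborel)"
  proof -
    have "0 \<le> sum_list (map norm ws)" by (intro sum_list_nonneg) auto
    then show ?thesis
      using Cons.IH by (simp add: ennreal_plus distrib_right add.commute add_right_mono)
  qed
  finally show ?case by (simp add: comp_def)
qed simp

lemma C1c_integrable:
  assumes "C1c f"
  shows "integrable lborel f"
proof -
  from assms obtain K where "compact K" "\<forall>x. x \<notin> K \<longrightarrow> f x = 0" by (auto simp: C1c_def)
  then show ?thesis
    using integrable_continuous_compact_support[of K UNIV f] C1c_continuous_on[OF assms] by auto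
qed

lemma C1c_integrable_horizontal_gradient:
  assumes "C1c f"
  shows "integrable lborel (\<lambda>\<xi>. norm (horizontal_gradient f \<xi>))"
proof -
  from assms obtain K where K: "compact K" "\<forall>x. x \<notin> K \<longrightarrow> f x = 0" by (auto simp: C1c_def)
  show ?thesis
  proof (rule integrable_continuous_compact_support[of K UNIV])
    show "continuous_on UNIV (\<lambda>\<xi>. norm (horizontal_gradient f \<xi>))"
      by (intro continuous_intros continuous_on_horizontal_gradient assms)
    show "norm (horizontal_gradient f \<xi>) = 0" if "\<xi> \<notin> K" for \<xi>
      using horizontal_gradient_zero_outside[of K f \<xi>] K that compact_imp_closed by auto
  qed (use K in auto)
qed

section \<open>The group product, boxes, and the weak type Sobolev inequality\<close>

definition rtrans :: "'n::finite heisenberg \<Rightarrow> 'n heisenberg \<Rightarrow> 'n heisenberg" where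
  "rtrans \<xi> h = (fst \<xi> + fst h, fst (snd \<xi>) + fst (snd h),
     snd (snd \<xi>) + snd (snd h) + 2 * (fst h \<bullet> fst (snd \<xi>) - fst \<xi> \<bullet> fst (snd h)))"

lemma continuous_on_rtrans [continuous_intros]:
  "continuous_on S f \<Longrightarrow> continuous_on S g \<Longrightarrow> continuous_on S (\<lambda>x. rtrans (f x) (g x))"
  unfolding rtrans_def by (intro continuous_intros)

text \<open>Here the right factor \<open>h\<close> is the variable of integration, so this is left
  invariance of the measure. The shift in \<open>t\<close> depends only on the horizontal part of
  \<open>h\<close>, hence it is a shear.\<close>

lemma nn_integral_rtrans:
  fixes F :: "'n::finite heisenberg \<Rightarrow> ennreal"
  assumes "F \<in> borel_measurable borel"
  shows "(\<integral>\<^sup>+h. F (rtrans \<xi> h) \<partial>lborel) = (\<integral>\<^sup>+h. F h \<partial>lborel)"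
  using nn_integral_lborel_shear[OF assms, of "\<lambda>a b. snd (snd \<xi>) + 2 * (a \<bullet> fst (snd \<xi>) - fst \<xi> \<bullet> b)" "fst \<xi>" "fst (snd \<xi>)"]
  by (simp add: continuous_intros rtrans_def add_ac)

text \<open>The vertical part of \<open>h\<close> is reached by a commutator of horizontal moves of length \<open>s\<close>,
  whose effect is the shift by \<open>- 4 * s\<^sup>2\<close> in \<open>t\<close>.\<close>

lemma pseudo_poincare:
  fixes f :: "'n::finite heisenberg \<Rightarrow> real"
  assumes f: "C1c f" and h: "norm (fst h) \<le> r" "norm (fst (snd h)) \<le> r"
    "- 4 * r\<^sup>2 \<le> snd (snd h)" "snd (snd h) \<le> 0" and r: "0 \<le> r"
  shows "(\<integral>\<^sup>+\<xi>. ennreal \<bar>f (rtrans \<xi> h) - f \<xi>\<bar> \<partial>lborel)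
    \<le> ennreal (6 * r) * (\<integral>\<^sup>+\<xi>. ennreal (norm (horizontal_gradient f \<xi>)) \<partial>lborel)"
proof -
  obtain e :: "real^'n" where e: "norm e = 1" using vector_choose_size[of 1] by auto
  then have ee: "e \<bullet> e = 1" by (simp add: norm_eq_1)
  \<comment> \<open>The commutator shifts \<open>t\<close> by \<open>- 4 * s\<^sup>2\<close>, and
    \<open>s\<close> solves \<open>4 * s\<^sup>2 = - snd (snd h)\<close>. The lower bound
    \<open>- 4 * r\<^sup>2\<close> on the vertical part is what makes
    \<open>s \<le> r\<close>.\<close>
  define s where "s = sqrt (- snd (snd h)) / 2"
  have s: "0 \<le> s" "s * s = - snd (snd h) / 4" using h by (auto simp: s_def)
  have "s * s \<le> r * r" using s h by (simp add: power2_eq_square)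
  then have sr: "s \<le> r" using r s by (metis abs_le_square_iff abs_of_nonneg power2_eq_square)
  define ws where "ws = [(fst h, fst (snd h)), (s *\<^sub>R e, 0), (0, s *\<^sub>R e), (- s *\<^sub>R e, 0), (0, - s *\<^sub>R e)]"
  have eq: "fold (\<lambda>w \<xi>. \<xi> + hfield w \<xi>) ws \<xi> = rtrans \<xi> h" for \<xi>
    using s ee by (simp add: ws_def rtrans_def hfield_def prod_eq_iff inner_simps inner_commute algebra_simps)
  \<comment> \<open>The constant 6: at most \<open>2 * r\<close> for the direct horizontal move, and
    four commutator moves of length \<open>s \<le> r\<close>.\<close>
  have "norm (fst h, fst (snd h)) \<le> 2 * r" using norm_Pair_le[of "fst h" "fst (snd h)"] h by linarith
  then have "sum_list (map norm ws) \<le> 6 * r" using s sr e by (simp add: ws_def norm_Pair)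
  then show ?thesis
    using nn_integral_horizontal_polygon_le[OF f, of ws] unfolding eq
    by (meson dual_order.trans ennreal_leI mult_right_mono zero_le)
qed

text \<open>The interval in \<open>t\<close> is one-sided because the commutator, run in a single
  orientation, only lowers \<open>t\<close>. The measure is still a constant times
  \<open>r ^ (2 * n + 2)\<close>, which is all that the averaging needs.\<close>

definition hbox :: "real \<Rightarrow> 'n::finite heisenberg set" where
  "hbox r = cball 0 r \<times> cball 0 r \<times> {- 4 * r\<^sup>2..0}"

lemma emeasure_lborel_Times:
  fixes A :: "'a::euclidean_space set" and B :: "'b::euclidean_space set"
  assumes "A \<in> sets borel" "B \<in> sets borel"
  shows "emeasure lborel (A \<times> B) = emeasure lborel A * emeasure lborel B"
  using lborel.emeasure_pair_measure_Times[of A lborel B] assms by (simp add: lborel_prod)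

lemma hbox_sets [measurable]: "hbox r \<in> sets borel"
  unfolding hbox_def by (intro borel_closed closed_Times closed_cball closed_atLeastAtMost)

lemma emeasure_hbox:
  assumes "0 \<le> r"
  shows "emeasure lborel (hbox r :: 'n::finite heisenberg set) =
    ennreal (4 * (unit_ball_vol (real CARD('n)))\<^sup>2 * r ^ (2 * CARD('n) + 2))"
  using assms
  by (simp add: hbox_def emeasure_lborel_Times emeasure_cball borel_closed closed_Times power2_eq_square
      power_add power_mult mult_ac flip: ennreal_mult)

text \<open>The exponent \<open>1 / Q\<close> is that of the box radius: the box must have measure
  \<open>2 * I\<close> with \<open>I\<close> the integral of \<open>f\<close>, which makes
  \<open>r\<close> a multiple of \<open>I powr (1 / Q)\<close>, and the pseudo-Poincare inequality
  costs one factor \<open>r\<close>. Fixing the level at 1 loses nothing, since the lemma is applied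
  to rescaled truncations.\<close>

lemma weak_sobolev:
  "\<exists>C>0. \<forall>f :: 'n::finite heisenberg \<Rightarrow> real. C1c f \<longrightarrow> (\<forall>x. 0 \<le> f x) \<longrightarrow>
    measure lborel {x. 1 \<le> f x} \<le>
      C * (\<integral>x. f x \<partial>lborel) powr (1 / (2 * real CARD('n) + 2)) * (\<integral>x. norm (horizontal_gradient f x) \<partial>lborel)"
proof -
  define n where "n = CARD('n)"
  define Q where "Q = 2 * real n + 2"
  define \<kappa> where "\<kappa> = 4 * (unit_ball_vol (real n))\<^sup>2"
  have \<kappa>: "0 < \<kappa>" unfolding \<kappa>_def by (intro mult_pos_pos zero_less_power) auto
  have Q: "0 < Q" by (simp add: Q_def)
  \<comment> \<open>\<open>hbox r\<close> has measure \<open>\<kappa> * r powr Q\<close>, so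
    \<open>(2 / \<kappa>) powr (1 / Q)\<close> is the factor in \<open>r\<close>. The 12 is the 6 of
    \<open>pseudo_poincare\<close> times the ratio of the box measure \<open>2 * I\<close> to the
    lower bound \<open>I\<close> in \<open>low\<close>.\<close>
  define C where "C = 12 * (2 / \<kappa>) powr (1 / Q)"
  have C: "0 < C" using \<kappa> by (simp add: C_def)
  have "measure lborel {x. 1 \<le> f x} \<le> C * (\<integral>x. f x \<partial>lborel) powr (1 / Q) * (\<integral>x. norm (horizontal_gradient f x) \<partial>lborel)"
    if f: "C1c f" and f0: "\<And>x. 0 \<le> f x" for f :: "'n heisenberg \<Rightarrow> real"
  proof -
    define I where "I = (\<integral>x. f x \<partial>lborel)"
    define N where "N = (\<integral>x. norm (horizontal_gradient f x) \<partial>lborel)"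
    define A where "A = {x. 1 \<le> f x}"
    have I0: "0 \<le> I" and N0: "0 \<le> N" by (auto simp: I_def N_def f0)
    have fc: "continuous_on UNIV f" by (rule C1c_continuous_on[OF f])
    have fm [measurable]: "f \<in> borel_measurable borel" by (rule borel_measurable_continuous_onI[OF fc])
    have nnI: "(\<integral>\<^sup>+x. ennreal (f x) \<partial>lborel) = ennreal I"
      unfolding I_def by (rule nn_integral_eq_integral[OF C1c_integrable[OF f]]) (simp add: f0)
    have nnN: "(\<integral>\<^sup>+x. ennreal (norm (horizontal_gradient f x)) \<partial>lborel) = ennreal N"
      unfolding N_def by (rule nn_integral_eq_integral[OF C1c_integrable_horizontal_gradient[OF f]]) simp
    have Am [measurable]: "A \<in> sets borel" unfolding A_def by measurable
    have "emeasure lborel A = (\<integral>\<^sup>+x. indicator A x \<partial>lborel)" by simp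
    also have "\<dots> \<le> (\<integral>\<^sup>+x. ennreal (f x) \<partial>lborel)"
      by (intro nn_integral_mono) (auto simp: A_def indicator_def)
    finally have AI: "emeasure lborel A \<le> ennreal I" using nnI by simp
    then have Afin: "emeasure lborel A = ennreal (measure lborel A)"
      by (intro emeasure_eq_ennreal_measure) (auto simp: top_unique)
    \<comment> \<open>If \<open>I = 0\<close> the box below would degenerate, but then
      \<open>A\<close> is already a null set.\<close>
    show ?thesis
    proof (cases "I = 0")
      case True
      then have "measure lborel A = 0" using AI Afin by (simp add: measure_nonneg)
      then show ?thesis using C N0 by (simp add: A_def N_def)
    next
      case False
      with I0 have I: "0 < I" by simp
      \<comment> \<open>\<open>hbox r\<close> has measure \<open>2 * I\<close>, so where \<open>f \<ge> 1\<close> it exceeds its mean over \<open>rtrans \<xi> ` hbox r\<close> by at least \<open>1/2\<close>.\<close>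
      define r where "r = (2 * I / \<kappa>) powr (1 / Q)"
      have r: "0 < r" using I \<kappa> by (simp add: r_def)
      have "r ^ (2 * n + 2) = r powr Q" using r by (simp add: powr_realpow[symmetric] Q_def add.commute del: power_Suc)
      also have "\<dots> = 2 * I / \<kappa>" using Q I \<kappa> by (simp add: r_def powr_powr)
      finally have P: "emeasure lborel (hbox r :: 'n heisenberg set) = ennreal (2 * I)"
        using r \<kappa> by (simp add: emeasure_hbox \<kappa>_def n_def)
      define H where "H = (\<lambda>\<xi> h. indicator (hbox r) h * ennreal \<bar>f (rtrans \<xi> h) - f \<xi>\<bar>)"
      have Hm: "(\<lambda>z. H (fst z) (snd z)) \<in> borel_measurable borel"
      proof -
        have "continuous_on UNIV (\<lambda>z::'n heisenberg \<times> 'n heisenberg. \<bar>f (rtrans (fst z) (snd z)) - f (fst z)\<bar>)"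
          by (intro continuous_intros continuous_on_compose2[OF fc]) auto
        then have [measurable]: "(\<lambda>z::'n heisenberg \<times> 'n heisenberg. \<bar>f (rtrans (fst z) (snd z)) - f (fst z)\<bar>) \<in> borel_measurable borel"
          by (rule borel_measurable_continuous_onI)
        have [measurable]: "(snd :: 'n heisenberg \<times> 'n heisenberg \<Rightarrow> _) \<in> borel_measurable borel"
          by (intro borel_measurable_continuous_onI continuous_intros)
        show ?thesis unfolding H_def by measurable
      qed
      have Hm1: "H \<xi> \<in> borel_measurable borel" for \<xi>
        using borel_measurable_Pair1[OF Hm, of \<xi>] by simp
      have low: "ennreal I \<le> (\<integral>\<^sup>+h. H \<xi> h \<partial>lborel)" if "\<xi> \<in> A" for \<xi>
      proof -
        have fr: "(\<lambda>h. ennreal (f (rtrans \<xi> h))) \<in> borel_measurable borel"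
          by (intro measurable_compose[OF borel_measurable_continuous_onI measurable_ennreal] continuous_on_compose2[OF fc] continuous_intros) auto
        have "ennreal (2 * I) = (\<integral>\<^sup>+h. indicator (hbox r) (h :: 'n heisenberg) \<partial>lborel)"
          using P by simp
        also have "\<dots> \<le> (\<integral>\<^sup>+h. H \<xi> h + ennreal (f (rtrans \<xi> h)) \<partial>lborel)"
        proof (intro nn_integral_mono)
          fix h :: "'n heisenberg"
          have "1 \<le> \<bar>f (rtrans \<xi> h) - f \<xi>\<bar> + f (rtrans \<xi> h)" using that by (auto simp: A_def)
          then have "(1::ennreal) \<le> ennreal \<bar>f (rtrans \<xi> h) - f \<xi>\<bar> + ennreal (f (rtrans \<xi> h))"
            using f0 by (simp flip: ennreal_plus)
          then show "indicator (hbox r) h \<le> H \<xi> h + ennreal (f (rtrans \<xi> h))"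
            by (auto simp: H_def indicator_def)
        qed
        also have "\<dots> = (\<integral>\<^sup>+h. H \<xi> h \<partial>lborel) + (\<integral>\<^sup>+h. ennreal (f (rtrans \<xi> h)) \<partial>lborel)"
          by (intro nn_integral_add) (use Hm1 fr in auto)
        also have "(\<integral>\<^sup>+h. ennreal (f (rtrans \<xi> h)) \<partial>lborel) = ennreal I"
          using nn_integral_rtrans[of "\<lambda>h. ennreal (f h)" \<xi>] nnI by simp
        finally have "ennreal I + ennreal I \<le> (\<integral>\<^sup>+h. H \<xi> h \<partial>lborel) + ennreal I"
          using I by (simp flip: ennreal_plus)
        then show ?thesis
          using ennreal_add_left_cancel_le[of "ennreal I" "ennreal I" "\<integral>\<^sup>+h. H \<xi> h \<partial>lborel"]
          by (simp add: add.commute)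
      qed
      have "ennreal (I * measure lborel A) = (\<integral>\<^sup>+\<xi>. ennreal I * indicator A \<xi> \<partial>lborel)"
        using I by (subst nn_integral_cmult_indicator) (auto simp: Afin ennreal_mult)
      also have "\<dots> \<le> (\<integral>\<^sup>+\<xi>. \<integral>\<^sup>+h. H \<xi> h \<partial>lborel \<partial>lborel)"
        by (intro nn_integral_mono) (auto simp: indicator_def low)
      also have "\<dots> = (\<integral>\<^sup>+h. \<integral>\<^sup>+\<xi>. H \<xi> h \<partial>lborel \<partial>lborel)"
        by (rule lborel_pair.Fubini'[symmetric]) (use Hm in \<open>simp add: lborel_prod case_prod_beta\<close>)
      also have "\<dots> \<le> (\<integral>\<^sup>+h. ennreal (6 * r * N) * indicator (hbox r) (h :: 'n heisenberg) \<partial>lborel)"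
      proof (intro nn_integral_mono)
        fix h :: "'n heisenberg"
        show "(\<integral>\<^sup>+\<xi>. H \<xi> h \<partial>lborel) \<le> ennreal (6 * r * N) * indicator (hbox r) h"
        proof (cases "h \<in> hbox r")
          case True
          then show ?thesis
            using pseudo_poincare[OF f, of h r] r N0
            by (simp add: H_def nnN hbox_def mem_Times_iff ennreal_mult)
        qed (simp add: H_def)
      qed
      also have "\<dots> = ennreal (6 * r * N * (2 * I))"
        using N0 r I by (subst nn_integral_cmult_indicator) (simp_all add: P flip: ennreal_mult)
      finally have "I * measure lborel A \<le> 6 * r * N * (2 * I)"
        using N0 r I by (subst (asm) ennreal_le_iff) auto
      then have "measure lborel A \<le> 12 * r * N" using I by (simp add: mult.commute mult.left_commute)
      also have "12 * r * N = C * I powr (1 / Q) * N"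
        using I \<kappa> by (simp add: C_def r_def powr_mult powr_divide)
      finally show ?thesis by (simp add: A_def I_def N_def)
    qed
  qed
  then show ?thesis using C unfolding Q_def n_def by blast
qed

section \<open>Powers of the absolute value and the chain rule in \<open>C1c\<close>\<close>

lemma has_real_derivative_pos_part_powr:
  fixes q :: real
  assumes "1 < q"
  shows "((\<lambda>x. max 0 x powr q) has_real_derivative q * max 0 x powr (q - 1)) (at x)"
proof -
  consider "0 < x" | "x < 0" | "x = 0" by linarith
  then show ?thesis
  proof cases
    case 1
    have "((\<lambda>x. x powr q) has_real_derivative q * max 0 x powr (q - 1)) (at x)"
      using 1 by (auto intro!: derivative_eq_intros)
    then show ?thesis
      by (rule has_field_derivative_transform_within_open[of _ _ _ "{0<..}"]) (use 1 in auto)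
  next
    case 2
    have "((\<lambda>x. 0) has_real_derivative q * max 0 x powr (q - 1)) (at x)"
      using 2 by (auto intro!: derivative_eq_intros)
    then show ?thesis
      by (rule has_field_derivative_transform_within_open[of _ _ _ "{..<0}"]) (use 2 in auto)
  next
    case 3
    \<comment> \<open>At 0 the difference quotient is at most
      \<open>\<bar>h\<bar> powr (q - 1)\<close>, which tends to 0 because
      \<open>1 < q\<close>.\<close>
    have lim: "((\<lambda>h::real. \<bar>h\<bar> powr (q - 1)) \<longlongrightarrow> \<bar>0\<bar> powr (q - 1)) (at 0)"
      using assms by (intro tendsto_powr' tendsto_intros) auto
    have "((\<lambda>h. max 0 h powr q / h) \<longlongrightarrow> 0) (at (0::real))"
    proof (rule Lim_null_comparison)
      show "\<forall>\<^sub>F h in at 0. norm (max 0 h powr q / h) \<le> \<bar>h\<bar> powr (q - 1)"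
      proof (rule always_eventually, rule allI)
        fix h :: real
        show "norm (max 0 h powr q / h) \<le> \<bar>h\<bar> powr (q - 1)"
        proof (cases "h \<le> 0")
          case False
          then show ?thesis by (simp add: powr_diff)
        qed simp
      qed
      show "((\<lambda>h::real. \<bar>h\<bar> powr (q - 1)) \<longlongrightarrow> 0) (at 0)"
        using lim by simp
    qed
    then show ?thesis using 3 assms by (simp add: DERIV_def)
  qed
qed

lemma has_real_derivative_abs_powr:
  fixes q :: real
  assumes "1 < q"
  shows "((\<lambda>x. \<bar>x\<bar> powr q) has_real_derivative q * (\<bar>x\<bar> powr (q - 1) * sgn x)) (at x)"
proof -
  have eq: "\<bar>x\<bar> powr q = max 0 x powr q + max 0 (- x) powr q" for x :: real
    by (auto simp: max_def abs_if)
  have "((\<lambda>x. max 0 (- x) powr q) has_real_derivative (q * max 0 (- x) powr (q - 1)) * (- 1)) (at x)"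
    by (rule DERIV_chain2[OF has_real_derivative_pos_part_powr[OF assms]]) (auto intro!: derivative_eq_intros)
  from DERIV_add[OF has_real_derivative_pos_part_powr[OF assms] this]
  have "((\<lambda>x. \<bar>x\<bar> powr q) has_real_derivative q * max 0 x powr (q - 1) + (q * max 0 (- x) powr (q - 1)) * (- 1)) (at x)"
    unfolding eq .
  moreover have "q * max 0 x powr (q - 1) + (q * max 0 (- x) powr (q - 1)) * (- 1) = q * (\<bar>x\<bar> powr (q - 1) * sgn x)"
    by (auto simp: max_def abs_if sgn_if)
  ultimately show ?thesis by simp
qed

text \<open>The jump of \<open>sgn\<close> at 0 is invisible once the function is written as a
  difference of powers of the positive and the negative part.\<close>

lemma continuous_on_abs_powr_sgn:
  fixes a :: real
  assumes "0 < a"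
  shows "continuous_on S (\<lambda>x. \<bar>x\<bar> powr a * sgn x)"
proof -
  have eq: "\<bar>x\<bar> powr a * sgn x = max 0 x powr a - max 0 (- x) powr a" for x :: real
    by (auto simp: max_def abs_if sgn_if)
  show ?thesis unfolding eq using assms
    by (intro continuous_intros continuous_on_powr') auto
qed

lemma continuous_on_powr_const:
  fixes f :: "'a::topological_space \<Rightarrow> real"
  assumes "continuous_on S f" "\<And>x. x \<in> S \<Longrightarrow> 0 \<le> f x" "0 < a"
  shows "continuous_on S (\<lambda>x. f x powr a)"
  using assms by (intro continuous_on_powr' continuous_on_const) auto

text \<open>A derivative formula is needed only on an open \<open>U\<close> around \<open>K\<close>:
  off \<open>K\<close> the function is locally 0, and \<open>U\<close> and \<open>- K\<close> are
  open and cover the space. This admits factors such as a negative power of the boundary distance,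
  which blow up at the boundary of \<open>U\<close>.\<close>

lemma C1cI:
  fixes f :: "'a::euclidean_space \<Rightarrow> real"
  assumes K: "compact K" "\<And>x. x \<notin> K \<Longrightarrow> f x = 0" and U: "open U" "K \<subseteq> U"
    and der: "\<And>x. x \<in> U \<Longrightarrow> (f has_derivative f' x) (at x)"
    and cont: "\<And>v. continuous_on U (\<lambda>x. f' x v)"
  shows "C1c f"
proof -
  have cl: "closed K" using K compact_imp_closed by blast
  have z: "(f has_derivative (\<lambda>_. 0)) (at x)" "frechet_derivative f (at x) = (\<lambda>_. 0)" if "x \<notin> K" for x
    using frechet_derivative_zero_outside[of K f x] cl K(2) that by auto
  have fd: "frechet_derivative f (at x) = f' x" if "x \<in> U" for x
    using frechet_derivative_at[OF der[OF that]] by simp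
  have d: "f differentiable (at x)" for x
    using der[of x] z(1)[of x] U(2) unfolding differentiable_def by blast
  have c: "continuous_on UNIV (\<lambda>x. frechet_derivative f (at x) v)" for v
  proof -
    have "continuous_on U (\<lambda>x. frechet_derivative f (at x) v)"
      using cont[of v] by (rule continuous_on_eq) (simp add: fd)
    moreover have "continuous_on (- K) (\<lambda>x. frechet_derivative f (at x) v)"
      by (rule continuous_on_eq[of _ "\<lambda>x. 0"]) (simp_all add: z)
    ultimately have "continuous_on (U \<union> - K) (\<lambda>x. frechet_derivative f (at x) v)"
      using U cl by (intro continuous_on_open_Un) auto
    moreover have "U \<union> - K = UNIV" using U by auto
    ultimately show ?thesis by simp
  qed
  show ?thesis unfolding C1c_def using d c K by auto
qed

lemma C1c_compose:
  fixes f :: "'a::euclidean_space \<Rightarrow> real"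
  assumes f: "C1c f" and \<phi>: "\<And>s. (\<phi> has_real_derivative \<phi>' s) (at s)" "continuous_on UNIV \<phi>'" "\<phi> 0 = 0"
  shows "C1c (\<lambda>x. \<phi> (f x))"
    and "frechet_derivative (\<lambda>x. \<phi> (f x)) (at x) v = \<phi>' (f x) * frechet_derivative f (at x) v"
proof -
  have d: "((\<lambda>x. \<phi> (f x)) has_derivative (\<lambda>v. \<phi>' (f x) * frechet_derivative f (at x) v)) (at x)" for x
    using has_derivative_compose[OF C1c_has_derivative[OF f, of x], of \<phi> "(*) (\<phi>' (f x))"] \<phi>(1)[of "f x"]
    by (simp add: has_field_derivative_def)
  then show "frechet_derivative (\<lambda>x. \<phi> (f x)) (at x) v = \<phi>' (f x) * frechet_derivative f (at x) v"
    by (simp add: frechet_derivative_at[OF d, symmetric])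
  from f obtain K where K: "compact K" "\<forall>x. x \<notin> K \<longrightarrow> f x = 0" by (auto simp: C1c_def)
  show "C1c (\<lambda>x. \<phi> (f x))"
  proof (rule C1cI[OF K(1) _ open_UNIV _ d])
    show "continuous_on UNIV (\<lambda>x. \<phi>' (f x) * frechet_derivative f (at x) v)" for v
      by (intro continuous_intros C1c_continuous_derivative[OF f] continuous_on_compose2[OF \<phi>(2) C1c_continuous_on[OF f]]) auto
  qed (use K \<phi>(3) in auto)
qed

lemma horizontal_gradient_compose:
  assumes "C1c f" "\<And>s. (\<phi> has_real_derivative \<phi>' s) (at s)" "continuous_on UNIV \<phi>'" "\<phi> 0 = 0"
  shows "horizontal_gradient (\<lambda>x. \<phi> (f x)) \<xi> = \<phi>' (f \<xi>) *\<^sub>R horizontal_gradient f \<xi>"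
  by (simp add: horizontal_gradient_def C1c_compose(2)[OF assms] prod_eq_iff vec_eq_iff)

text \<open>A \<open>C\<^sup>1\<close> truncation, so that the truncated functions stay in \<open>C1c\<close>.\<close>

definition step_fun :: "real \<Rightarrow> real" where
  "step_fun s = 2 * (max 0 (s - 1) powr 2 - 2 * max 0 (s - 3/2) powr 2 + max 0 (s - 2) powr 2)"

text \<open>A tent on the interval from 1 to 2, of height 2 at 3/2. Its area is 1, so its primitive
  rises from 0 to 1.\<close>

definition step_fun' :: "real \<Rightarrow> real" where
  "step_fun' s = 4 * (max 0 (s - 1) - 2 * max 0 (s - 3/2) + max 0 (s - 2))"

lemma step_fun_derivative: "(step_fun has_real_derivative step_fun' s) (at s)"
proof -
  have d: "((\<lambda>s. max 0 (s - c) powr 2) has_real_derivative 2 * max 0 (s - c)) (at s)" for c :: real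
  proof -
    have "((\<lambda>s. s - c) has_real_derivative 1) (at s)"
      by (auto intro!: derivative_eq_intros)
    from DERIV_chain2[where f = "\<lambda>x. max 0 x powr 2" and g = "\<lambda>s. s - c",
        OF has_real_derivative_pos_part_powr this]
    show ?thesis by simp
  qed
  have "step_fun' s = 2 * (2 * max 0 (s - 1) - 2 * (2 * max 0 (s - 3/2)) + 2 * max 0 (s - 2))"
    by (simp add: step_fun'_def)
  then show ?thesis unfolding step_fun_def[abs_def]
    by (simp only:) (intro DERIV_cmult DERIV_add DERIV_diff d)
qed

lemma continuous_on_step_fun': "continuous_on S step_fun'"
  unfolding step_fun'_def[abs_def] by (intro continuous_intros)

lemma step_fun'_bounds: "0 \<le> step_fun' s" "step_fun' s \<le> 2"
  by (cases "s \<le> 1"; cases "s \<le> 3/2"; cases "s \<le> 2"; simp add: step_fun'_def max_absorb1 max_absorb2)+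

lemma step_fun'_eq_0: "s \<le> 1 \<or> 2 \<le> s \<Longrightarrow> step_fun' s = 0"
  by (auto simp: step_fun'_def max_absorb1 max_absorb2)

lemma step_fun_eq_0: "s \<le> 1 \<Longrightarrow> step_fun s = 0"
  by (simp add: step_fun_def max_absorb1)

lemma step_fun_eq_1:
  assumes "2 \<le> s"
  shows "step_fun s = 1"
proof -
  have m: "max 0 (s - 1) = s - 1" "max 0 (s - 3/2) = s - 3/2" "max 0 (s - 2) = s - 2"
    using assms by auto
  have "step_fun s = 2 * ((s - 1)\<^sup>2 - 2 * (s - 3/2)\<^sup>2 + (s - 2)\<^sup>2)"
    using assms unfolding step_fun_def m by simp
  also have "\<dots> = 1" by (simp add: power2_eq_square algebra_simps)
  finally show ?thesis .
qed

lemma step_fun_bounds: "0 \<le> step_fun s" "step_fun s \<le> 1"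
proof -
  have mono: "step_fun a \<le> step_fun b" if "a \<le> b" for a b
    using that by (rule DERIV_nonneg_imp_nondecreasing) (use step_fun_derivative step_fun'_bounds(1) in blast)
  show "0 \<le> step_fun s" using mono[of "min s 1" s] step_fun_eq_0[of "min s 1"] by simp
  show "step_fun s \<le> 1" using mono[of s "max s 2"] step_fun_eq_1[of "max s 2"] by simp
qed

text \<open>The hypothesis \<open>step\<close> is the weak type inequality for the truncation between two consecutive
  levels; absorbing the sum itself into it turns it into the strong inequality.\<close>

lemma dyadic_sum:
  fixes a :: "nat \<Rightarrow> real"
  assumes a: "\<And>j. 0 \<le> a j" "summable a" and D: "\<And>j. 0 \<le> D j" "\<And>J. (\<Sum>j<J. D j) \<le> E"
    and c: "0 \<le> c" and e: "0 < e" "e < 1"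
    and step: "\<And>j. a j \<le> c * a (Suc j) powr e * D j"
  shows "suminf a powr (1 - e) \<le> c * E"
proof -
  define S where "S = suminf a"
  have S0: "0 \<le> S" unfolding S_def using a by (intro suminf_nonneg)
  have "(\<Sum>j<J. a j) \<le> c * S powr e * E" for J
  proof -
    have "(\<Sum>j<J. a j) \<le> (\<Sum>j<J. c * S powr e * D j)"
    proof (rule sum_mono)
      fix j
      have "a (Suc j) \<le> S" unfolding S_def using sum_le_suminf[OF a(2), of "{Suc j}"] a(1) by auto
      then have "a (Suc j) powr e \<le> S powr e" using a e by (intro powr_mono2) auto
      then show "a j \<le> c * S powr e * D j"
        using step[of j] c D(1)[of j] by (meson mult_left_mono mult_right_mono order_trans)
    qed
    also have "\<dots> = c * S powr e * (\<Sum>j<J. D j)" by (simp add: sum_distrib_left)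
    also have "\<dots> \<le> c * S powr e * E" using c D by (intro mult_left_mono) auto
    finally show ?thesis .
  qed
  then have le: "S \<le> c * S powr e * E" unfolding S_def by (intro suminf_le_const a)
  have E0: "0 \<le> E" using D(2)[of 0] by simp
  show ?thesis
  proof (cases "S = 0")
    case True
    then show ?thesis using c E0 by (simp add: S_def)
  next
    case False
    then have "S powr (1 - e) * S powr e = S" using S0 by (simp flip: powr_add)
    moreover have "c * S powr e * E = (c * E) * S powr e" by simp
    ultimately have "S powr (1 - e) * S powr e \<le> (c * E) * S powr e"
      using le by linarith
    moreover have "0 < S powr e" using False S0 by simp
    ultimately show ?thesis
      unfolding S_def[symmetric] by (rule mult_right_le_imp_le)
  qed
qed

section \<open>The \<open>L\<^sup>1\<close> Sobolev inequality\<close>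

lemma C1c_bounded:
  assumes "C1c g"
  obtains M where "0 < M" "\<And>x. \<bar>g x\<bar> < M"
proof -
  from assms obtain K where K: "compact K" "\<forall>x. x \<notin> K \<longrightarrow> g x = 0" by (auto simp: C1c_def)
  have "bounded (g ` K)"
    by (intro compact_imp_bounded compact_continuous_image C1c_continuous_on assms K)
  then obtain B where B: "0 < B" "\<forall>x\<in>K. \<bar>g x\<bar> \<le> B" by (auto simp: bounded_pos)
  show thesis
  proof (rule that[of "B + 1"])
    show "\<bar>g x\<bar> < B + 1" for x using B K by (cases "x \<in> K") force+
  qed (use B in simp)
qed

text \<open>Truncation method: between two consecutive levels the truncated function has its
  gradient in one layer of \<open>g\<close>. The layers are disjoint, so the weak inequalities can
  be summed without losing more than the total gradient.\<close>

lemma sobolev_L1: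
  "\<exists>C>0. \<forall>g :: 'n::finite heisenberg \<Rightarrow> real. C1c g \<longrightarrow> (\<forall>x. 0 \<le> g x) \<longrightarrow>
    (\<integral>x. g x powr ((2 * real CARD('n) + 2) / (2 * real CARD('n) + 1)) \<partial>lborel)
        powr ((2 * real CARD('n) + 1) / (2 * real CARD('n) + 2))
      \<le> C * (\<integral>x. norm (horizontal_gradient g x) \<partial>lborel)"
proof -
  define Q where "Q = 2 * real CARD('n) + 2"
  define \<theta> where "\<theta> = Q / (Q - 1)"
  have Q: "1 < Q" by (simp add: Q_def)
  \<comment> \<open>\<open>\<theta> / Q = \<theta> - 1\<close> makes the levels match: at level
    \<open>e\<close>, the factor \<open>e powr \<theta> / e\<close> equals
    \<open>(e powr \<theta>) powr (1 / Q)\<close>, which is what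
    \<open>a (Suc j) powr (1 / Q)\<close> requires. The exponent left by \<open>dyadic_sum\<close>
    is then \<open>1 - 1 / Q = 1 / \<theta>\<close>.\<close>
  have \<theta>: "1 < \<theta>" "\<theta> / Q = \<theta> - 1" "1 / \<theta> = 1 - 1 / Q"
    using Q by (auto simp: \<theta>_def field_simps)
  obtain C0 where C0: "0 < C0" and weak: "\<And>f :: 'n heisenberg \<Rightarrow> real. C1c f \<Longrightarrow> (\<And>x. 0 \<le> f x) \<Longrightarrow>
      measure lborel {x. 1 \<le> f x} \<le> C0 * (\<integral>x. f x \<partial>lborel) powr (1 / Q) * (\<integral>x. norm (horizontal_gradient f x) \<partial>lborel)"
    using weak_sobolev[where 'n = 'n] unfolding Q_def by blast
  \<comment> \<open>\<open>2 powr \<theta>\<close> comes from passing from \<open>c j\<close> to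
    \<open>c (Suc j)\<close>, and the other 2 bounds \<open>step_fun'\<close>. The further factor 2
    in \<open>main\<close> is lost when \<open>g powr \<theta>\<close> is compared with the sum over
    the levels.\<close>
  define C1 where "C1 = 2 * 2 powr \<theta> * C0"
  have C1: "0 < C1" using C0 by (simp add: C1_def)
  have main: "(\<integral>x. g x powr \<theta> \<partial>lborel) powr (1 / \<theta>) \<le> (2 * C1) * (\<integral>x. norm (horizontal_gradient g x) \<partial>lborel)"
    if g: "C1c g" and g0: "\<And>x. 0 \<le> g x" for g :: "'n heisenberg \<Rightarrow> real"
  proof -
    define N where "N = (\<integral>x. norm (horizontal_gradient g x) \<partial>lborel)"
    have gc: "continuous_on S g" for S by (rule C1c_continuous_on[OF g])
    have gm [measurable]: "g \<in> borel_measurable borel" by (rule borel_measurable_continuous_onI[OF gc])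
    from g obtain K where K: "compact K" "\<And>x. x \<notin> K \<Longrightarrow> g x = 0" by (auto simp: C1c_def)
    obtain M where M: "0 < M" "\<And>x. \<bar>g x\<bar> < M" using C1c_bounded[OF g] by blast
    \<comment> \<open>The levels descend from a strict upper bound of \<open>g\<close>, so natural
      numbers index all the layers, and \<open>a\<close> below decays geometrically. The resulting
      summability is what allows \<open>dyadic_sum\<close> to absorb the sum.\<close>
    define c where "c j = M / 2 ^ j" for j :: nat
    have c0: "0 < c j" for j using M by (simp add: c_def)
    have cS: "c j = 2 * c (Suc j)" for j by (simp add: c_def)
    define m where "m j = measure lborel {x. c j \<le> g x}" for j
    define D where "D j = (\<integral>x. indicator {x. c (Suc j) \<le> g x \<and> g x < c j} x *\<^sub>R norm (horizontal_gradient g x) \<partial>lborel)" for j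
    have fm: "A \<in> fmeasurable lborel" if "A \<in> sets borel" "A \<subseteq> K" for A
      using fmeasurableI2[OF fmeasurable_compact[OF K(1)] that(2)] that(1) by simp
    have lev: "{x. c j \<le> g x} \<in> fmeasurable lborel" for j
    proof (rule fm)
      show "{x. c j \<le> g x} \<subseteq> K" using c0[of j] K(2) by force
    qed measurable
    have Dint: "integrable lborel (\<lambda>x. indicator {x. c (Suc j) \<le> g x \<and> g x < c j} x *\<^sub>R norm (horizontal_gradient g x))" for j
      by (intro integrable_mult_indicator C1c_integrable_horizontal_gradient g) measurable
    have D0: "0 \<le> D j" for j by (simp add: D_def)
    have Dsum: "(\<Sum>j<J. D j) \<le> N" for J
    proof -
      have "(\<Sum>j<J. D j) = (\<integral>x. (\<Sum>j<J. indicator {x. c (Suc j) \<le> g x \<and> g x < c j} x *\<^sub>R norm (horizontal_gradient g x)) \<partial>lborel)"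
        unfolding D_def by (rule Bochner_Integration.integral_sum[symmetric]) (rule Dint)
      also have "\<dots> \<le> N" unfolding N_def
      proof (rule integral_mono)
        fix x
        have dec: "c j \<le> c i" if "i \<le> j" for i j
          unfolding c_def using that M by (intro divide_left_mono power_increasing) auto
        \<comment> \<open>A point lies in at most one layer, since the levels decrease.\<close>
        have "(\<Sum>j<J. indicator {x. c (Suc j) \<le> g x \<and> g x < c j} x :: real) \<le> 1"
        proof (cases "\<exists>i<J. c (Suc i) \<le> g x \<and> g x < c i")
          case True
          then obtain i where i: "i < J" "c (Suc i) \<le> g x" "g x < c i" by blast
          have "indicator {x. c (Suc j) \<le> g x \<and> g x < c j} x = (if j = i then 1 else 0 :: real)" for j
          proof (cases "j < i")
            case True
            then show ?thesis using dec[of "Suc j" i] i by (auto simp: indicator_def)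
          next
            case False
            then show ?thesis using dec[of "Suc i" j] i by (cases "j = i") (auto simp: indicator_def)
          qed
          then show ?thesis using i by simp
        next
          case False
          then have "(\<Sum>j<J. indicator {x. c (Suc j) \<le> g x \<and> g x < c j} x :: real) = 0"
            by (intro sum.neutral) (auto simp: indicator_def)
          then show ?thesis by simp
        qed
        then have "(\<Sum>j<J. indicator {x. c (Suc j) \<le> g x \<and> g x < c j} x) * norm (horizontal_gradient g x) \<le> 1 * norm (horizontal_gradient g x)"
          by (rule mult_right_mono) simp
        then show "(\<Sum>j<J. indicator {x. c (Suc j) \<le> g x \<and> g x < c j} x *\<^sub>R norm (horizontal_gradient g x)) \<le> norm (horizontal_gradient g x)"
          by (simp add: sum_distrib_right)
      next
        show "integrable lborel (\<lambda>x. \<Sum>j<J. indicator {x. c (Suc j) \<le> g x \<and> g x < c j} x *\<^sub>R norm (horizontal_gradient g x))"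
          by (rule Bochner_Integration.integrable_sum) (rule Dint)
      qed (rule C1c_integrable_horizontal_gradient[OF g])
      finally show ?thesis .
    qed
    define a where "a j = c j powr \<theta> * m j" for j
    have step: "a j \<le> C1 * a (Suc j) powr (1 / Q) * D j" for j
    proof -
      define e where "e = c (Suc j)"
      have e: "0 < e" "c j = 2 * e" using c0[of "Suc j"] cS[of j] by (simp_all add: e_def)
      define f where "f x = step_fun (g x / e)" for x
      have \<phi>: "((\<lambda>s. step_fun (s / e)) has_real_derivative step_fun' (s / e) / e) (at s)" for s
      proof -
        have "((\<lambda>s. s / e) has_real_derivative 1 / e) (at s)"
          by (rule DERIV_cdivide[OF DERIV_ident])
        from DERIV_chain2[where f = step_fun and g = "\<lambda>s. s / e", OF step_fun_derivative this]
        show ?thesis by simp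
      qed
      have \<phi>c: "continuous_on UNIV (\<lambda>s. step_fun' (s / e) / e)"
        using e by (intro continuous_intros continuous_on_compose2[OF continuous_on_step_fun'[of UNIV]]) auto
      have \<phi>0: "step_fun (0 / e) = 0" by (simp add: step_fun_eq_0)
      have f: "C1c f" unfolding f_def[abs_def] by (rule C1c_compose(1)[OF g \<phi> \<phi>c \<phi>0])
      have hf: "horizontal_gradient f x = (step_fun' (g x / e) / e) *\<^sub>R horizontal_gradient g x" for x
        unfolding f_def[abs_def] by (rule horizontal_gradient_compose[OF g \<phi> \<phi>c \<phi>0])
      have fmm [measurable]: "f \<in> borel_measurable borel"
        by (rule borel_measurable_continuous_onI[OF C1c_continuous_on[OF f]])
      have f0: "0 \<le> f x" for x by (simp add: f_def step_fun_bounds)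
      have "m j \<le> measure lborel {x. 1 \<le> f x}" unfolding m_def
      proof (rule measure_mono_fmeasurable)
        show "{x. c j \<le> g x} \<subseteq> {x. 1 \<le> f x}"
          using e by (auto simp: f_def step_fun_eq_1 field_simps)
        show "{x. 1 \<le> f x} \<in> fmeasurable lborel"
        proof (rule fm)
          show "{x. 1 \<le> f x} \<subseteq> K"
            using K(2) by (force simp: f_def step_fun_eq_0)
        qed measurable
      qed simp
      also have "\<dots> \<le> C0 * (\<integral>x. f x \<partial>lborel) powr (1 / Q) * (\<integral>x. norm (horizontal_gradient f x) \<partial>lborel)"
        by (rule weak[OF f f0])
      also have "\<dots> \<le> C0 * m (Suc j) powr (1 / Q) * (2 / e * D j)"
      proof (intro mult_mono powr_mono2 mult_left_mono)
        have "(\<integral>x. f x \<partial>lborel) \<le> (\<integral>x. indicator {x. e \<le> g x} x \<partial>lborel)"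
        proof (rule integral_mono)
          show "integrable lborel (indicat_real {x. e \<le> g x})"
            using lev[of "Suc j"] by (simp add: e_def fmeasurable_def)
          show "f x \<le> indicator {x. e \<le> g x} x" for x
            using e step_fun_bounds(2)[of "g x / e"] by (auto simp: f_def indicator_def step_fun_eq_0)
        qed (rule C1c_integrable[OF f])
        then show "(\<integral>x. f x \<partial>lborel) \<le> m (Suc j)" by (simp add: m_def e_def)
        have "(\<integral>x. norm (horizontal_gradient f x) \<partial>lborel) \<le> (\<integral>x. 2 / e * (indicator {x. c (Suc j) \<le> g x \<and> g x < c j} x *\<^sub>R norm (horizontal_gradient g x)) \<partial>lborel)"
        proof (rule integral_mono)
          fix x
          have "\<bar>step_fun' (g x / e) / e\<bar> \<le> 2 / e * indicator {x. c (Suc j) \<le> g x \<and> g x < c j} x"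
          proof (cases "e \<le> g x \<and> g x < 2 * e")
            case True
            then show ?thesis using e step_fun'_bounds[of "g x / e"] by (simp add: e_def[symmetric] divide_right_mono)
          next
            case False
            then have "g x / e \<le> 1 \<or> 2 \<le> g x / e" using e by (auto simp: field_simps)
            then show ?thesis using e by (simp add: step_fun'_eq_0)
          qed
          from mult_right_mono[OF this norm_ge_zero]
          show "norm (horizontal_gradient f x) \<le> 2 / e * (indicator {x. c (Suc j) \<le> g x \<and> g x < c j} x *\<^sub>R norm (horizontal_gradient g x))"
            by (simp add: hf mult.assoc)
        qed (intro C1c_integrable_horizontal_gradient f integrable_mult_right Dint)+
        then show "(\<integral>x. norm (horizontal_gradient f x) \<partial>lborel) \<le> 2 / e * D j"
          by (simp add: D_def)
      qed (use C0 Q f0 in auto)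
      finally have "a j \<le> (2 * e) powr \<theta> * (C0 * m (Suc j) powr (1 / Q) * (2 / e * D j))"
        unfolding a_def e(2) by (rule mult_left_mono) simp
      also have "\<dots> = C1 * (e powr \<theta> / e) * m (Suc j) powr (1 / Q) * D j"
        using e by (simp add: C1_def powr_mult)
      also have "e powr \<theta> / e = (e powr \<theta>) powr (1 / Q)"
        using e \<theta> by (simp add: powr_powr powr_diff)
      also have "C1 * (e powr \<theta>) powr (1 / Q) * m (Suc j) powr (1 / Q) = C1 * a (Suc j) powr (1 / Q)"
        by (simp add: a_def e_def powr_mult m_def)
      finally show ?thesis .
    qed
    have a0: "0 \<le> a j" for j by (simp add: a_def m_def)
    have asum: "summable a"
    proof (rule summable_comparison_test')
      show "summable (\<lambda>j. M powr \<theta> * measure lborel K * (2 powr - \<theta>) ^ j)"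
        using \<theta> by (intro summable_mult summable_geometric) (simp add: powr_less_one)
      fix j :: nat
      have "m j \<le> measure lborel K" unfolding m_def
        by (rule measure_mono_fmeasurable) (use c0[of j] K(2) lev fmeasurable_compact[OF K(1)] in \<open>force simp: fmeasurable_def\<close>)+
      moreover have "c j powr \<theta> = M powr \<theta> * (2 powr - \<theta>) ^ j"
      proof -
        have "c j = M * 2 powr (- real j)"
          by (simp add: c_def powr_minus powr_realpow divide_inverse)
        then have "c j powr \<theta> = M powr \<theta> * 2 powr (- real j * \<theta>)"
          using M by (simp add: powr_mult powr_powr)
        then show ?thesis by (simp add: powr_power mult.commute)
      qed
      ultimately have "a j \<le> (M powr \<theta> * (2 powr - \<theta>) ^ j) * measure lborel K"
        unfolding a_def by (metis mult_left_mono powr_ge_zero)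
      then show "norm (a j) \<le> M powr \<theta> * measure lborel K * (2 powr - \<theta>) ^ j"
        using a0[of j] by (simp add: mult_ac)
    qed
    have S: "suminf a powr (1 / \<theta>) \<le> C1 * N"
      unfolding \<theta>(3) by (rule dyadic_sum[OF a0 asum D0 Dsum _ _ _ step]) (use C1 Q in auto)
    define T where "T = (\<integral>x. g x powr \<theta> \<partial>lborel)"
    have T0: "0 \<le> T" by (simp add: T_def)
    have gt: "integrable lborel (\<lambda>x. g x powr \<theta>)"
      by (rule integrable_continuous_compact_support[of K UNIV])
        (use K \<theta> g0 in \<open>auto intro!: continuous_on_powr_const gc\<close>)
    have "ennreal T = (\<integral>\<^sup>+x. ennreal (g x powr \<theta>) \<partial>lborel)"
      unfolding T_def by (rule nn_integral_eq_integral[OF gt, symmetric]) simp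
    also have "\<dots> \<le> (\<integral>\<^sup>+x. (\<Sum>j. ennreal (2 powr \<theta> * c j powr \<theta>) * indicator {x. c j \<le> g x} x) \<partial>lborel)"
    proof (intro nn_integral_mono)
      fix x
      show "ennreal (g x powr \<theta>) \<le> (\<Sum>j. ennreal (2 powr \<theta> * c j powr \<theta>) * indicator {x. c j \<le> g x} x)"
      proof (cases "g x = 0")
        case False
        then have gx: "0 < g x" using g0[of x] by simp
        have "\<exists>j. c j \<le> g x"
        proof -
          obtain j where "M / g x < 2 ^ j" using real_arch_pow[of 2 "M / g x"] by auto
          then show ?thesis using gx by (intro exI[of _ j]) (simp add: c_def field_simps)
        qed
        \<comment> \<open>The first level not above \<open>g x\<close>. Minimality gives
          \<open>g x < c (j - 1) = 2 * c j\<close>, where \<open>j \<noteq> 0\<close> because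
          \<open>c 0 = M\<close> exceeds \<open>g\<close>. This single term of the series already
          dominates \<open>g x powr \<theta>\<close>.\<close>
        then obtain j where j: "c j \<le> g x" "\<And>i. i < j \<Longrightarrow> \<not> c i \<le> g x"
          using exists_least_iff[of "\<lambda>j. c j \<le> g x"] by blast
        have "c 0 = M" by (simp add: c_def)
        then have "j \<noteq> 0" using j(1) M(2)[of x] by (metis abs_ge_self linorder_not_less order_trans)
        then obtain i where i: "j = Suc i" using not0_implies_Suc by blast
        then have "g x \<le> 2 * c j" using j(2)[of i] cS[of i] by simp
        then have "g x powr \<theta> \<le> (2 * c j) powr \<theta>" using gx \<theta> by (intro powr_mono2) auto
        then have "ennreal (g x powr \<theta>) \<le> ennreal (2 powr \<theta> * c j powr \<theta>) * indicator {x. c j \<le> g x} x"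
          using j(1) c0[of j] by (simp add: powr_mult ennreal_leI)
        also have "\<dots> \<le> (\<Sum>j. ennreal (2 powr \<theta> * c j powr \<theta>) * indicator {x. c j \<le> g x} x)"
        proof -
          have "t j \<le> suminf t" for t :: "nat \<Rightarrow> ennreal"
            using sum_le_suminf[of t "{j}"] by simp
          then show ?thesis .
        qed
        finally show ?thesis .
      qed simp
    qed
    also have "\<dots> = (\<Sum>j. \<integral>\<^sup>+x. ennreal (2 powr \<theta> * c j powr \<theta>) * indicator {x. c j \<le> g x} x \<partial>lborel)"
      by (rule nn_integral_suminf) measurable
    also have "\<dots> = (\<Sum>j. ennreal (2 powr \<theta> * a j))"
    proof (rule suminf_cong)
      fix j
      show "(\<integral>\<^sup>+x. ennreal (2 powr \<theta> * c j powr \<theta>) * indicator {x. c j \<le> g x} x \<partial>lborel) = ennreal (2 powr \<theta> * a j)"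
        using lev[of j] by (subst nn_integral_cmult_indicator)
          (auto simp: a_def m_def emeasure_eq_measure2 ennreal_mult mult.assoc)
    qed
    also have "\<dots> = ennreal (\<Sum>j. 2 powr \<theta> * a j)"
      by (rule suminf_ennreal2) (use a0 asum in \<open>auto intro!: summable_mult\<close>)
    also have "(\<Sum>j. 2 powr \<theta> * a j) = 2 powr \<theta> * suminf a" by (rule suminf_mult[OF asum])
    finally have "T \<le> 2 powr \<theta> * suminf a"
      using suminf_nonneg[OF asum a0] by (subst (asm) ennreal_le_iff) auto
    then have "T powr (1 / \<theta>) \<le> (2 powr \<theta> * suminf a) powr (1 / \<theta>)"
      using T0 \<theta>(1) by (intro powr_mono2) auto
    also have "\<dots> = 2 * suminf a powr (1 / \<theta>)"
      using suminf_nonneg[OF asum a0] \<theta>(1) by (simp add: powr_mult powr_powr)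
    also have "\<dots> \<le> 2 * (C1 * N)" using S by simp
    finally show ?thesis by (simp add: T_def N_def)
  qed
  have e1: "(2 * real CARD('n) + 2) / (2 * real CARD('n) + 1) = \<theta>"
    and e2: "(2 * real CARD('n) + 1) / (2 * real CARD('n) + 2) = 1 / \<theta>"
    by (simp_all add: \<theta>_def Q_def)
  show ?thesis unfolding e1 e2 using main C1 by (intro exI[of _ "2 * C1"]) auto
qed

section \<open>The normal derivative\<close>

lemma integral_lborel_translate:
  fixes f :: "'a::euclidean_space \<Rightarrow> real"
  assumes [measurable]: "f \<in> borel_measurable borel"
  shows "(\<integral>x. f (x + c) \<partial>lborel) = (\<integral>x. f x \<partial>lborel)"
proof -
  have "(\<integral>x. f x \<partial>lborel) = (\<integral>x. f x \<partial>(distr lborel borel ((+) c)))"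
    by (simp add: lborel_distr_plus)
  also have "\<dots> = (\<integral>x. f (x + c) \<partial>lborel)"
    by (subst integral_distr) (auto simp: add.commute)
  finally show ?thesis by simp
qed

text \<open>Since \<open>z\<close> is constant along \<open>b\<close>, multiplying a difference
  quotient of \<open>h\<close> by \<open>z\<close> gives a difference quotient of
  \<open>z * h\<close>, whose integral is 0 by translation invariance. Dominated convergence then
  passes to the derivative, without differentiating \<open>z\<close>.\<close>

lemma integral_directional_derivative:
  fixes h :: "'a::euclidean_space \<Rightarrow> real"
  assumes h: "C1c h" and z: "continuous_on UNIV z" "\<And>x s. z (x + s *\<^sub>R b) = z x"
  shows "(\<integral>x. z x * frechet_derivative h (at x) b \<partial>lborel) = 0"
proof -
  from h obtain K where K: "compact K" "\<And>x. x \<notin> K \<Longrightarrow> h x = 0" by (auto simp: C1c_def)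
  obtain r where r: "0 < r" "\<And>x. x \<in> K \<Longrightarrow> norm x \<le> r"
    using compact_imp_bounded[OF K(1)] by (auto simp: bounded_pos)
  have "compact ((\<lambda>x. frechet_derivative h (at x) b) ` K)"
    by (intro compact_continuous_image C1c_continuous_derivative h K)
  then obtain B where B: "0 < B" "\<And>x. x \<in> K \<Longrightarrow> \<bar>frechet_derivative h (at x) b\<bar> \<le> B"
    using compact_imp_bounded by (force simp: bounded_pos)
  have B': "\<bar>frechet_derivative h (at x) b\<bar> \<le> B" for x
    using B frechet_derivative_zero_outside(2)[OF compact_imp_closed[OF K(1)] K(2)] by (cases "x \<in> K") auto
  \<comment> \<open>Leaves room for the shifts \<open>s n *\<^sub>R b\<close>, of norm at most
    \<open>norm b\<close>, so that one ball contains the supports of all the difference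
    quotients.\<close>
  define R where "R = r + norm b"
  have "compact (z ` cball 0 R)"
    by (intro compact_continuous_image continuous_on_subset[OF z(1)]) auto
  then obtain Z where Z: "0 < Z" "\<And>x. x \<in> cball 0 R \<Longrightarrow> \<bar>z x\<bar> \<le> Z"
    using compact_imp_bounded by (force simp: bounded_pos)
  define s where "s n = inverse (real (Suc n))" for n
  have s: "0 < s n" "s n \<le> 1" for n by (auto simp: s_def field_simps)
  have slim: "s \<longlonglongrightarrow> 0" unfolding s_def[abs_def] by (rule LIMSEQ_inverse_real_of_nat)
  define F where "F n x = z x * ((h (x + s n *\<^sub>R b) - h x) / s n)" for n x
  have hc: "continuous_on S h" for S by (rule C1c_continuous_on[OF h])
  have tc: "continuous_on UNIV (\<lambda>x. h (x + c))" for c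
    by (rule continuous_on_compose2[OF hc[of UNIV]]) (auto intro!: continuous_intros)
  have Fc: "continuous_on UNIV (F n)" for n
    unfolding F_def[abs_def] using s[of n] by (intro continuous_intros z(1) hc tc) auto
  have der: "((\<lambda>t. h (x + t *\<^sub>R b)) has_real_derivative frechet_derivative h (at (x + t *\<^sub>R b)) b) (at t)" for x t
  proof -
    have "((\<lambda>t. h (x + t *\<^sub>R b)) has_derivative (\<lambda>k. frechet_derivative h (at (x + t *\<^sub>R b)) (k *\<^sub>R b))) (at t)"
      by (rule has_derivative_compose[OF _ C1c_has_derivative[OF h]]) (auto intro!: derivative_eq_intros)
    then show ?thesis
      by (simp add: has_field_derivative_def linear_cmul[OF linear_frechet_derivative[OF C1c_differentiable[OF h]]] mult_commute_abs)
  qed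
  have zero: "(\<integral>x. F n x \<partial>lborel) = 0" for n
  proof -
    define G where "G x = z x * h x" for x
    have Gc: "continuous_on UNIV G" unfolding G_def[abs_def] by (intro continuous_intros z(1) hc)
    have Gi: "integrable lborel G"
      by (rule integrable_continuous_compact_support[OF K(1) _ Gc]) (auto simp: G_def K(2))
    have Gm: "G \<in> borel_measurable borel" by (rule borel_measurable_continuous_onI[OF Gc])
    have Gi2: "integrable lborel (\<lambda>x. G (x + s n *\<^sub>R b))"
    proof -
      have "integrable (distr lborel borel ((+) (s n *\<^sub>R b))) G" by (simp add: lborel_distr_plus Gi)
      then show ?thesis by (subst (asm) integrable_distr_eq) (auto simp: Gm add.commute)
    qed
    have "F n = (\<lambda>x. (G (x + s n *\<^sub>R b) - G x) / s n)"
      by (simp add: F_def G_def z(2) algebra_simps fun_eq_iff diff_divide_distrib)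
    then show ?thesis using Gi Gi2 integral_lborel_translate[OF Gm] by simp
  qed
  have "(\<lambda>n. \<integral>x. F n x \<partial>lborel) \<longlonglongrightarrow> (\<integral>x. z x * frechet_derivative h (at x) b \<partial>lborel)"
  proof (rule integral_dominated_convergence)
    show "(\<lambda>x. z x * frechet_derivative h (at x) b) \<in> borel_measurable lborel"
      using borel_measurable_continuous_onI[OF continuous_on_mult[OF z(1) C1c_continuous_derivative[OF h]]] by simp
    show "F n \<in> borel_measurable lborel" for n
      using borel_measurable_continuous_onI[OF Fc] by simp
    show "integrable lborel (\<lambda>x. indicator (cball 0 R) x *\<^sub>R (Z * B))"
      using borel_integrable_compact[of "cball 0 R" "\<lambda>x. Z * B"] by simp
    show "AE x in lborel. (\<lambda>n. F n x) \<longlonglongrightarrow> z x * frechet_derivative h (at x) b"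
    proof (rule AE_I2)
      fix x
      have "((\<lambda>t. (h (x + t *\<^sub>R b) - h x) / t) \<longlongrightarrow> frechet_derivative h (at x) b) (at 0)"
        using der[of x 0] by (simp add: DERIV_def)
      moreover have "filterlim s (at 0) sequentially"
        using slim s by (auto simp: filterlim_at less_imp_neq[symmetric] intro!: always_eventually)
      ultimately have "(\<lambda>n. (h (x + s n *\<^sub>R b) - h x) / s n) \<longlonglongrightarrow> frechet_derivative h (at x) b"
        by (rule filterlim_compose)
      then show "(\<lambda>n. F n x) \<longlonglongrightarrow> z x * frechet_derivative h (at x) b"
        unfolding F_def by (intro tendsto_intros)
    qed
    show "AE x in lborel. norm (F n x) \<le> indicator (cball 0 R) x *\<^sub>R (Z * B)" for n
    proof (rule AE_I2)
      fix x
      have q: "\<bar>(h (x + s n *\<^sub>R b) - h x) / s n\<bar> \<le> B"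
      proof -
        obtain t where "h (x + s n *\<^sub>R b) - h (x + 0 *\<^sub>R b) = (s n - 0) * frechet_derivative h (at (x + t *\<^sub>R b)) b"
          using MVT2[of 0 "s n" "\<lambda>t. h (x + t *\<^sub>R b)" "\<lambda>t. frechet_derivative h (at (x + t *\<^sub>R b)) b"] s der by blast
        then show ?thesis using s[of n] B' by (simp add: abs_mult)
      qed
      show "norm (F n x) \<le> indicator (cball 0 R) x *\<^sub>R (Z * B)"
      proof (cases "x \<in> cball 0 R")
        case True
        have "norm (F n x) = \<bar>z x\<bar> * \<bar>(h (x + s n *\<^sub>R b) - h x) / s n\<bar>"
          by (simp only: F_def real_norm_def abs_mult)
        also have "\<dots> \<le> Z * B"
          using Z(2)[OF True] q Z(1) by (intro mult_mono) auto
        finally show ?thesis using True by simp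
      next
        case False
        have "norm (s n *\<^sub>R b) \<le> norm b" using s[of n] by (simp add: mult_left_le_one_le)
        then have "norm x - norm b \<le> norm (x + s n *\<^sub>R b)"
          using norm_diff_ineq[of x "s n *\<^sub>R b"] by linarith
        then have "x \<notin> K" "x + s n *\<^sub>R b \<notin> K"
          using False r(2)[of x] r(2)[of "x + s n *\<^sub>R b"] norm_ge_zero[of b] by (auto simp: R_def simp del: norm_ge_zero)
        then show ?thesis using Z(1) B(1) by (simp add: F_def K(2))
      qed
    qed
  qed
  then show ?thesis by (simp add: zero LIMSEQ_const_iff)
qed

section \<open>The vectors \<open>N\<close> in coordinates and integration along
  \<open>Z\<close>\<close>

definition hnormal :: "'n::finite heisenberg \<Rightarrow> 'n heisenberg \<Rightarrow> (real^'n) \<times> (real^'n)" where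
  "hnormal \<nu> \<xi> = (fst \<nu> + (2 * snd (snd \<nu>)) *\<^sub>R fst (snd \<xi>), fst (snd \<nu>) - (2 * snd (snd \<nu>)) *\<^sub>R fst \<xi>)"

lemma continuous_on_hnormal [continuous_intros]:
  "continuous_on S f \<Longrightarrow> continuous_on S (\<lambda>x. hnormal \<nu> (f x))"
  unfolding hnormal_def by (intro continuous_intros)

text \<open>The left side is the derivative of the boundary distance along \<open>hfield w\<close>.
  For \<open>w = hnormal \<nu> \<xi>\<close> it becomes \<open>Z D = W\<^sup>2\<close>.\<close>

lemma hfield_inner_normal: "hfield w \<xi> \<bullet> \<nu> = w \<bullet> hnormal \<nu> \<xi>"
  by (simp add: hfield_def hnormal_def inner_prod_def inner_simps inner_commute algebra_simps)

lemma angle_function_eq_norm: "angle_function \<nu> \<xi> = norm (hnormal \<nu> \<xi>)"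
proof -
  have X: "X_field i \<xi> \<bullet> \<nu> = fst (hnormal \<nu> \<xi>) $ i" for i
    by (simp add: X_field_def hnormal_def inner_prod_def inner_axis' case_prod_beta)
  have Y: "Y_field i \<xi> \<bullet> \<nu> = snd (hnormal \<nu> \<xi>) $ i" for i
    by (simp add: Y_field_def hnormal_def inner_prod_def inner_axis' case_prod_beta)
  show ?thesis
    by (simp add: angle_function_def X Y norm_prod_def norm_vec_def L2_set_def sum_nonneg sum.distrib)
qed

text \<open>The \<open>x\<close> part of \<open>z\<close> depends only on \<open>y\<close>, the
  \<open>y\<close> part only on \<open>x\<close>, and the \<open>t\<close> part only on
  \<open>(x, y)\<close>. Each basis direction therefore falls under
  \<open>integral_directional_derivative\<close> separately.\<close>

lemma integral_normal_derivative:
  fixes h :: "'n::finite heisenberg \<Rightarrow> real"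
  assumes h: "C1c h"
  shows "(\<integral>\<xi>. horizontal_gradient h \<xi> \<bullet> hnormal \<nu> \<xi> \<partial>lborel) = 0"
proof -
  define z where "z \<xi> = hfield (hnormal \<nu> \<xi>) \<xi>" for \<xi>
  have zc: "continuous_on UNIV z" unfolding z_def[abs_def] by (intro continuous_intros)
  have eq: "horizontal_gradient h \<xi> \<bullet> hnormal \<nu> \<xi> = (\<Sum>b\<in>Basis. (z \<xi> \<bullet> b) * frechet_derivative h (at \<xi>) b)" for \<xi>
  proof -
    interpret linear "frechet_derivative h (at \<xi>)"
      by (rule linear_frechet_derivative[OF C1c_differentiable[OF h]])
    have "horizontal_gradient h \<xi> \<bullet> hnormal \<nu> \<xi> = frechet_derivative h (at \<xi>) (z \<xi>)"
      by (simp add: z_def frechet_derivative_hfield[OF C1c_differentiable[OF h]])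
    also have "z \<xi> = (\<Sum>b\<in>Basis. (z \<xi> \<bullet> b) *\<^sub>R b)" by (simp add: euclidean_representation)
    finally show ?thesis by (simp add: sum scaleR)
  qed
  from h obtain K where K: "compact K" "\<And>x. x \<notin> K \<Longrightarrow> h x = 0" by (auto simp: C1c_def)
  have int: "integrable lborel (\<lambda>\<xi>. (z \<xi> \<bullet> b) * frechet_derivative h (at \<xi>) b)" for b
    by (rule integrable_continuous_compact_support[of K UNIV])
      (use K frechet_derivative_zero_outside(2)[OF compact_imp_closed[OF K(1)] K(2)]
        in \<open>auto intro!: continuous_intros zc C1c_continuous_derivative[OF h]\<close>)
  have "(\<integral>\<xi>. (z \<xi> \<bullet> b) * frechet_derivative h (at \<xi>) b \<partial>lborel) = 0" if "b \<in> Basis" for b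
  proof (rule integral_directional_derivative[OF h])
    show "continuous_on UNIV (\<lambda>\<xi>. z \<xi> \<bullet> b)" by (intro continuous_intros zc)
    show "z (\<xi> + s *\<^sub>R b) \<bullet> b = z \<xi> \<bullet> b" for \<xi> s
      using that by (auto simp: Basis_prod_def z_def hfield_def hnormal_def)
  qed
  then show ?thesis unfolding eq by (simp add: Bochner_Integration.integral_sum int)
qed

text \<open>The unweighted identity for \<open>w * h\<close>: in the product rule the term with the
  derivative of \<open>w\<close> along \<open>Z\<close> vanishes by \<open>w0\<close>.\<close>

lemma integral_weighted_normal_derivative:
  fixes h w :: "'n::finite heisenberg \<Rightarrow> real"
  assumes h: "C1c h"
    and w: "\<And>\<xi>. (w has_derivative w' \<xi>) (at \<xi>)" "\<And>v. continuous_on UNIV (\<lambda>\<xi>. w' \<xi> v)"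
    and w0: "\<And>\<xi>. w' \<xi> (hfield (hnormal \<nu> \<xi>) \<xi>) = 0"
  shows "(\<integral>\<xi>. w \<xi> * (horizontal_gradient h \<xi> \<bullet> hnormal \<nu> \<xi>) \<partial>lborel) = 0"
proof -
  from h obtain K where K: "compact K" "\<And>x. x \<notin> K \<Longrightarrow> h x = 0" by (auto simp: C1c_def)
  have wc: "continuous_on UNIV w"
    using w(1) has_derivative_continuous by (blast intro: continuous_at_imp_continuous_on)
  have d: "((\<lambda>\<xi>. w \<xi> * h \<xi>) has_derivative (\<lambda>v. w \<xi> * frechet_derivative h (at \<xi>) v + w' \<xi> v * h \<xi>)) (at \<xi>)" for \<xi>
    by (rule has_derivative_mult[OF w(1) C1c_has_derivative[OF h]])
  have c: "C1c (\<lambda>\<xi>. w \<xi> * h \<xi>)"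
    by (rule C1cI[OF K(1) _ open_UNIV _ d])
      (use K in \<open>auto intro!: continuous_intros wc C1c_continuous_on[OF h] C1c_continuous_derivative[OF h] w(2)\<close>)
  have "horizontal_gradient (\<lambda>\<xi>. w \<xi> * h \<xi>) \<xi> \<bullet> hnormal \<nu> \<xi> = w \<xi> * (horizontal_gradient h \<xi> \<bullet> hnormal \<nu> \<xi>)" for \<xi>
    using frechet_derivative_hfield[OF C1c_differentiable[OF c], of \<xi> "hnormal \<nu> \<xi>"]
      frechet_derivative_hfield[OF C1c_differentiable[OF h], of \<xi> "hnormal \<nu> \<xi>"]
    by (simp add: frechet_derivative_at[OF d, symmetric] w0)
  then show ?thesis using integral_normal_derivative[OF c, of \<nu>] by simp
qed

text \<open>\<open>e > 0\<close> removes the singularity where \<open>W = 0\<close>, which happens on a line when \<open>\<nu>\<^sub>t \<noteq> 0\<close>.\<close>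

lemma integral_angle_eps_normal_derivative:
  fixes h :: "'n::finite heisenberg \<Rightarrow> real"
  assumes h: "C1c h" and e: "0 < e"
  shows "(\<integral>\<xi>. ((angle_function \<nu> \<xi>)\<^sup>2 + e) powr \<alpha> * (horizontal_gradient h \<xi> \<bullet> hnormal \<nu> \<xi>) \<partial>lborel) = 0"
proof -
  define L where "L v = ((2 * snd (snd \<nu>)) *\<^sub>R fst (snd v), - ((2 * snd (snd \<nu>)) *\<^sub>R fst v))" for v :: "'n heisenberg"
  have dn: "(hnormal \<nu> has_derivative L) (at \<xi>)" for \<xi>
    unfolding hnormal_def[abs_def] L_def[abs_def] by (auto intro!: derivative_eq_intros)
  have pos: "0 < hnormal \<nu> \<xi> \<bullet> hnormal \<nu> \<xi> + e" for \<xi>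
    using e inner_ge_zero[of "hnormal \<nu> \<xi>"] by linarith
  have d1: "((\<lambda>\<xi>. hnormal \<nu> \<xi> \<bullet> hnormal \<nu> \<xi> + e) has_derivative (\<lambda>v. 2 * (hnormal \<nu> \<xi> \<bullet> L v))) (at \<xi>)" for \<xi>
    by (rule derivative_eq_intros dn refl)+ (simp add: inner_commute)
  have d2: "((\<lambda>s. s powr \<alpha>) has_derivative (\<lambda>k. (\<alpha> * s powr (\<alpha> - 1)) * k)) (at s)" if "0 < s" for s :: real
    using has_real_derivative_powr[OF that, of \<alpha>]
    by (simp add: has_field_derivative_def)
  have d: "((\<lambda>\<xi>. (hnormal \<nu> \<xi> \<bullet> hnormal \<nu> \<xi> + e) powr \<alpha>) has_derivative
      (\<lambda>v. \<alpha> * (hnormal \<nu> \<xi> \<bullet> hnormal \<nu> \<xi> + e) powr (\<alpha> - 1) * (2 * (hnormal \<nu> \<xi> \<bullet> L v)))) (at \<xi>)" for \<xi>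
    using has_derivative_compose[OF d1 d2[OF pos]] .
  have "(\<integral>\<xi>. (hnormal \<nu> \<xi> \<bullet> hnormal \<nu> \<xi> + e) powr \<alpha> * (horizontal_gradient h \<xi> \<bullet> hnormal \<nu> \<xi>) \<partial>lborel) = 0"
  proof (rule integral_weighted_normal_derivative[OF h d])
    show "continuous_on UNIV (\<lambda>\<xi>. \<alpha> * (hnormal \<nu> \<xi> \<bullet> hnormal \<nu> \<xi> + e) powr (\<alpha> - 1) * (2 * (hnormal \<nu> \<xi> \<bullet> L v)))" for v
      using less_imp_neq[OF pos] by (intro continuous_intros) auto
    \<comment> \<open>This is \<open>Z W = 0\<close>: on \<open>Z\<close>, the derivative
      \<open>L\<close> of \<open>hnormal\<close> gives \<open>2 \<nu>\<^sub>t\<close> times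
      \<open>N\<close> turned by a right angle, which is orthogonal to \<open>N\<close>.\<close>
    show "\<alpha> * (hnormal \<nu> \<xi> \<bullet> hnormal \<nu> \<xi> + e) powr (\<alpha> - 1) * (2 * (hnormal \<nu> \<xi> \<bullet> L (hfield (hnormal \<nu> \<xi>) \<xi>))) = 0" for \<xi>
      by (simp add: L_def hfield_def inner_prod_def[of "hnormal \<nu> \<xi>"] inner_commute)
  qed
  then show ?thesis by (simp add: angle_function_eq_norm power2_norm_eq_inner)
qed

text \<open>Limit of the regularised identity. Because \<open>0 \<le> a\<close>, the integrand with
  \<open>e = 1\<close> dominates all the others.\<close>

lemma integral_angle_powr_normal_derivative:
  fixes h :: "'n::finite heisenberg \<Rightarrow> real"
  assumes h: "C1c h" and a: "0 \<le> a"
  shows "integrable lborel (\<lambda>\<xi>. angle_function \<nu> \<xi> powr a * (horizontal_gradient h \<xi> \<bullet> hnormal \<nu> \<xi>))"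
    and "(\<integral>\<xi>. angle_function \<nu> \<xi> powr a * (horizontal_gradient h \<xi> \<bullet> hnormal \<nu> \<xi>) \<partial>lborel) = 0"
proof -
  let ?W = "angle_function \<nu>"
  from h obtain K where K: "compact K" "\<And>x. x \<notin> K \<Longrightarrow> h x = 0" by (auto simp: C1c_def)
  have hz: "horizontal_gradient h \<xi> = 0" if "\<xi> \<notin> K" for \<xi>
    using horizontal_gradient_zero_outside[OF compact_imp_closed K(2) that] K by simp
  have Wc: "continuous_on UNIV ?W" unfolding angle_function_eq_norm[abs_def] by (intro continuous_intros)
  have W0: "0 \<le> ?W \<xi>" for \<xi> by (simp add: angle_function_eq_norm)
  let ?H = "\<lambda>\<xi>. horizontal_gradient h \<xi> \<bullet> hnormal \<nu> \<xi>"
  have Hc: "continuous_on UNIV ?H" by (intro continuous_intros continuous_on_horizontal_gradient h)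
  define e where "e n = inverse (real (Suc n))" for n
  have e: "0 < e n" "e n \<le> 1" for n by (auto simp: e_def field_simps)
  have elim: "e \<longlonglongrightarrow> 0" unfolding e_def[abs_def] by (rule LIMSEQ_inverse_real_of_nat)
  have pos: "0 < (?W \<xi>)\<^sup>2 + e n" for \<xi> n using e[of n] by (simp add: add_nonneg_pos)
  let ?F = "\<lambda>n \<xi>. ((?W \<xi>)\<^sup>2 + e n) powr (a / 2) * ?H \<xi>"
  have Fc: "continuous_on UNIV (?F n)" for n
    using less_imp_neq[OF pos] by (intro continuous_intros Wc Hc) auto
  let ?G = "\<lambda>\<xi>. ((?W \<xi>)\<^sup>2 + 1) powr (a / 2) * \<bar>?H \<xi>\<bar>"
  have lim: "(\<lambda>n. ?F n \<xi>) \<longlonglongrightarrow> ?W \<xi> powr a * ?H \<xi>" for \<xi>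
  \<comment> \<open>Where \<open>N = 0\<close> the inner product vanishes for every \<open>n\<close>
    and in the limit, so the value of \<open>0 powr a\<close> does not matter, even for
    \<open>a = 0\<close>.\<close>
  proof (cases "hnormal \<nu> \<xi> = 0")
    case False
    then have W: "0 < ?W \<xi>" by (simp add: angle_function_eq_norm)
    have "(\<lambda>n. ((?W \<xi>)\<^sup>2 + e n) powr (a / 2)) \<longlonglongrightarrow> ((?W \<xi>)\<^sup>2 + 0) powr (a / 2)"
      by (intro tendsto_intros elim) (use W in auto)
    moreover have "((?W \<xi>)\<^sup>2 + 0) powr (a / 2) = ?W \<xi> powr a"
      using W by (simp add: powr_powr flip: powr_numeral)
    ultimately have "(\<lambda>n. ((?W \<xi>)\<^sup>2 + e n) powr (a / 2)) \<longlonglongrightarrow> ?W \<xi> powr a" by (simp only:)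
    then show ?thesis by (rule tendsto_mult_right)
  qed simp
  have Fm: "?F n \<in> borel_measurable lborel" for n
    using borel_measurable_continuous_onI[OF Fc, of n] by simp
  have Wm: "(\<lambda>\<xi>. ?W \<xi> powr a * ?H \<xi>) \<in> borel_measurable lborel"
    by (rule borel_measurable_LIMSEQ_real[OF lim Fm])
  have Gi: "integrable lborel ?G"
  proof (rule integrable_continuous_compact_support[OF K(1)])
    have "(?W \<xi>)\<^sup>2 + 1 \<noteq> 0" for \<xi> using zero_le_power2[of "?W \<xi>"] by linarith
    then show "continuous_on UNIV ?G" by (intro continuous_intros Wc Hc) auto
  qed (simp_all add: hz)
  have bd: "AE \<xi> in lborel. norm (?F n \<xi>) \<le> ?G \<xi>" for n
  proof (rule AE_I2)
    fix \<xi>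
    have "((?W \<xi>)\<^sup>2 + e n) powr (a / 2) \<le> ((?W \<xi>)\<^sup>2 + 1) powr (a / 2)"
      using a e[of n] pos[of \<xi> n] by (intro powr_mono2) auto
    then show "norm (?F n \<xi>) \<le> ?G \<xi>"
      by (simp add: abs_mult mult_right_mono)
  qed
  have limAE: "AE \<xi> in lborel. (\<lambda>n. ?F n \<xi>) \<longlonglongrightarrow> ?W \<xi> powr a * ?H \<xi>" using lim by simp
  show "integrable lborel (\<lambda>\<xi>. ?W \<xi> powr a * ?H \<xi>)"
    by (rule integrable_dominated_convergence[OF Wm Fm Gi limAE bd])
  have "(\<lambda>n. \<integral>\<xi>. ?F n \<xi> \<partial>lborel) \<longlonglongrightarrow> (\<integral>\<xi>. ?W \<xi> powr a * ?H \<xi> \<partial>lborel)"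
    by (rule integral_dominated_convergence[OF Wm Fm Gi limAE bd])
  moreover have "(\<integral>\<xi>. ?F n \<xi> \<partial>lborel) = 0" for n
    by (rule integral_angle_eps_normal_derivative[OF h e(1)])
  ultimately show "(\<integral>\<xi>. ?W \<xi> powr a * ?H \<xi> \<partial>lborel) = 0"
    by (simp add: LIMSEQ_const_iff)
qed

section \<open>Inequalities for powers\<close>

lemma add_powr_le_powr_add:
  fixes a b t :: real
  assumes "0 \<le> a" "0 \<le> b" "1 \<le> t"
  shows "a powr t + b powr t \<le> (a + b) powr t"
proof (cases "a + b = 0")
  case True
  then have "a = 0" "b = 0" using assms by auto
  then show ?thesis by simp
next
  case False
  then have s: "0 < a + b" using assms by auto
  have *: "x powr t \<le> x * (a + b) powr (t - 1)" if "0 \<le> x" "x \<le> a + b" for x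
  proof (cases "x = 0")
    case False
    then have "x powr t = x * x powr (t - 1)" using that by (simp add: powr_diff)
    also have "\<dots> \<le> x * (a + b) powr (t - 1)"
      using that assms by (intro mult_left_mono powr_mono2) auto
    finally show ?thesis .
  qed simp
  have "a powr t + b powr t \<le> (a + b) * (a + b) powr (t - 1)"
    using *[of a] *[of b] assms by (simp add: distrib_right)
  also have "\<dots> = (a + b) powr t" using s by (simp add: powr_diff)
  finally show ?thesis .
qed

text \<open>Convexity of \<open>norm v powr p\<close>, obtained from Cauchy-Schwarz and Young's
  inequality with exponents \<open>p / (p - 1)\<close> and \<open>p\<close> instead of by
  differentiation.\<close>

lemma powr_norm_tangent:
  fixes v m :: "'a::real_inner"
  assumes "1 < p"
  shows "norm v powr p + p * norm v powr (p - 2) * (v \<bullet> (m - v)) \<le> norm m powr p"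
proof (cases "v = 0")
  case False
  then have nv: "0 < norm v" by simp
  have e1: "norm v powr (p - 2) * (v \<bullet> v) = norm v powr p"
  proof -
    have "v \<bullet> v = norm v powr 2" using nv by (simp add: power2_norm_eq_inner)
    then show ?thesis by (simp only: powr_add[symmetric]) simp
  qed
  have "norm v powr (p - 2) * (v \<bullet> m) \<le> norm v powr (p - 2) * (norm v * norm m)"
    by (intro mult_left_mono norm_cauchy_schwarz) simp
  also have "\<dots> = norm v powr (p - 1) * norm m"
  proof -
    have "norm v powr (p - 2) * norm v powr 1 = norm v powr (p - 1)"
      unfolding powr_add[symmetric] by simp
    then show ?thesis using nv by (simp add: mult.assoc[symmetric])
  qed
  also have "\<dots> \<le> (norm v powr (p - 1)) powr (p / (p - 1)) / (p / (p - 1)) + norm m powr p / p"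
    using assms by (intro Youngs_inequality) (auto simp: field_simps)
  also have "\<dots> = norm v powr p * ((p - 1) / p) + norm m powr p / p"
    using assms by (simp add: powr_powr)
  finally have "p * (norm v powr (p - 2) * (v \<bullet> m)) \<le> p * (norm v powr p * ((p - 1) / p) + norm m powr p / p)"
    using assms by (intro mult_left_mono) auto
  also have "\<dots> = (p - 1) * norm v powr p + norm m powr p" using assms by (simp add: field_simps)
  finally have "p * (norm v powr (p - 2) * (v \<bullet> m)) \<le> (p - 1) * norm v powr p + norm m powr p" .
  moreover have "p * norm v powr (p - 2) * (v \<bullet> (m - v)) = p * (norm v powr (p - 2) * (v \<bullet> m)) - p * norm v powr p"
    by (simp add: inner_diff_right right_diff_distrib mult.assoc e1)
  ultimately show ?thesis by (simp add: left_diff_distrib)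
qed simp

text \<open>The parallelogram law settles the squares of the norms. Raising to the power
  \<open>p / 2 \<ge> 1\<close> uses superadditivity for the half sum and half difference, and
  convexity for \<open>v\<close> and \<open>w\<close>.\<close>

lemma clarkson_inner:
  fixes v w :: "'a::real_inner"
  assumes "2 \<le> p"
  shows "2 * norm ((1/2) *\<^sub>R (v + w)) powr p + 2 * norm ((1/2) *\<^sub>R (w - v)) powr p \<le> norm v powr p + norm w powr p"
proof -
  let ?m = "norm ((1/2) *\<^sub>R (v + w))" and ?d = "norm ((1/2) *\<^sub>R (w - v))"
  define t where "t = p / 2"
  have t: "1 \<le> t" using assms by (simp add: t_def)
  have sq: "norm x powr p = ((norm x)\<^sup>2) powr t" for x :: 'a
    by (cases "x = 0") (simp_all add: t_def powr_powr flip: powr_numeral)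
  have par: "?m\<^sup>2 + ?d\<^sup>2 = ((norm v)\<^sup>2 + (norm w)\<^sup>2) / 2"
    by (simp add: power2_norm_eq_inner inner_simps inner_commute field_simps)
  have conv: "(x / 2 + y / 2) powr t \<le> x powr t / 2 + y powr t / 2" if "0 \<le> x" "0 \<le> y" for x y :: real
  proof (cases "x = 0 \<or> y = 0")
    case True
    have "(z / 2) powr t \<le> z powr t / 2" if "0 \<le> z" for z :: real
    proof -
      have "2 powr 1 \<le> (2::real) powr t" using t by (intro powr_mono) auto
      then have "z powr t / 2 powr t \<le> z powr t / 2" by (intro divide_left_mono) auto
      then show ?thesis using that by (simp only: powr_divide)
    qed
    then show ?thesis using True that by auto
  next
    case False
    then have xy: "0 < x" "0 < y" using that by auto
    show ?thesis
      using convex_onD[OF powr_convex[OF t], of "1/2" x y] xy by simp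
  qed
  have "?m powr p + ?d powr p \<le> (?m\<^sup>2 + ?d\<^sup>2) powr t"
    unfolding sq by (intro add_powr_le_powr_add t) auto
  also have "\<dots> \<le> (norm v powr p + norm w powr p) / 2"
    using conv[of "(norm v)\<^sup>2" "(norm w)\<^sup>2"] unfolding par sq by (simp add: add_divide_distrib)
  finally show ?thesis by simp
qed

text \<open>The tangent inequality at \<open>a\<close> is applied to the midpoint of
  \<open>a\<close> and \<open>a + b\<close>, at distance \<open>b / 2\<close>. Clarkson's inequality
  for this pair doubles it, which restores the full linear term and leaves
  \<open>2 * norm (b / 2) powr p\<close>, the source of \<open>2 powr (1 - p)\<close>.\<close>

lemma powr_norm_add_ge:
  fixes a b :: "'a::real_inner"
  assumes p: "2 \<le> p"
  shows "norm a powr p + p * norm a powr (p - 2) * (a \<bullet> b) + 2 powr (1 - p) * norm b powr p \<le> norm (a + b) powr p"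
proof -
  let ?m = "(1/2) *\<^sub>R (a + (a + b))"
  have ma: "?m - a = (1/2) *\<^sub>R b" by (simp add: algebra_simps flip: scaleR_2)
  have "norm a powr p + p * norm a powr (p - 2) * (a \<bullet> (?m - a)) \<le> norm ?m powr p"
    using p by (intro powr_norm_tangent) simp
  moreover have "2 * norm ?m powr p + 2 * norm ((1/2) *\<^sub>R (a + b - a)) powr p \<le> norm a powr p + norm (a + b) powr p"
    by (rule clarkson_inner[OF p])
  moreover have "2 * norm ((1/2) *\<^sub>R (a + b - a)) powr p = 2 powr (1 - p) * norm b powr p"
    by (simp add: powr_divide powr_diff)
  ultimately show ?thesis by (simp add: ma)
qed

text \<open>Young's inequality for the normalised factors. Adding \<open>e > 0\<close> keeps the
  normalisers positive when one of the integrals is 0; \<open>e\<close> tends to 0 at the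
  end.\<close>

lemma Holder_inequality_powr:
  fixes f g :: "'a \<Rightarrow> real"
  assumes ab: "1 < a" "1 < b" "1 / a + 1 / b = 1"
    and f0: "\<And>x. 0 \<le> f x" and g0: "\<And>x. 0 \<le> g x"
    and fi: "integrable M (\<lambda>x. f x powr a)" and gi: "integrable M (\<lambda>x. g x powr b)"
    and fgi: "integrable M (\<lambda>x. f x * g x)"
  shows "(\<integral>x. f x * g x \<partial>M) \<le> (\<integral>x. f x powr a \<partial>M) powr (1 / a) * (\<integral>x. g x powr b \<partial>M) powr (1 / b)"
proof -
  define F where "F = (\<integral>x. f x powr a \<partial>M)"
  define G where "G = (\<integral>x. g x powr b \<partial>M)"
  have F0: "0 \<le> F" and G0: "0 \<le> G" by (auto simp: F_def G_def)
  have le: "(\<integral>x. f x * g x \<partial>M) \<le> (F + e) powr (1 / a) * (G + e) powr (1 / b)" if e: "0 < e" for e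
  proof -
    define A where "A = (F + e) powr (1 / a)"
    define B where "B = (G + e) powr (1 / b)"
    have A: "0 < A" and B: "0 < B" using F0 G0 e by (auto simp: A_def B_def)
    have Aa: "A powr a = F + e" and Bb: "B powr b = G + e"
      using F0 G0 e ab by (auto simp: A_def B_def powr_powr)
    have "(\<integral>x. f x * g x \<partial>M) = (\<integral>x. A * B * (f x / A * (g x / B)) \<partial>M)"
      using A B by simp
    also have "\<dots> \<le> (\<integral>x. A * B * (f x powr a / (F + e) / a + g x powr b / (G + e) / b) \<partial>M)"
    proof (rule integral_mono)
      show "integrable M (\<lambda>x. A * B * (f x / A * (g x / B)))" using fgi A B by simp
      show "integrable M (\<lambda>x. A * B * (f x powr a / (F + e) / a + g x powr b / (G + e) / b))"
        using fi gi by (intro integrable_mult_right integrable_add) auto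
      fix x
      have "f x / A * (g x / B) \<le> (f x / A) powr a / a + (g x / B) powr b / b"
        using ab A B f0 g0 by (intro Youngs_inequality) auto
      also have "\<dots> = f x powr a / (F + e) / a + g x powr b / (G + e) / b"
        using A B f0 g0 by (simp add: powr_divide Aa Bb)
      finally show "A * B * (f x / A * (g x / B)) \<le> A * B * (f x powr a / (F + e) / a + g x powr b / (G + e) / b)"
        using A B by (intro mult_left_mono) auto
    qed
    also have "\<dots> = A * B * (F / (F + e) / a + G / (G + e) / b)"
      using fi gi by (simp add: F_def G_def)
    also have "\<dots> \<le> A * B * (1 / a + 1 / b)"
      using A B F0 G0 e ab by (intro mult_left_mono add_mono divide_right_mono) auto
    finally show ?thesis using ab by (simp add: A_def B_def)
  qed
  have "((\<lambda>e. (F + e) powr (1 / a) * (G + e) powr (1 / b)) \<longlongrightarrow> (F + 0) powr (1 / a) * (G + 0) powr (1 / b)) (at_right 0)"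
    using ab F0 G0 by (intro tendsto_mult tendsto_powr' tendsto_intros) (auto simp: eventually_at_filter)
  moreover have "\<forall>\<^sub>F e in at_right 0. (\<integral>x. f x * g x \<partial>M) \<le> (F + e) powr (1 / a) * (G + e) powr (1 / b)"
    using le by (auto simp: eventually_at_filter)
  ultimately have "(\<integral>x. f x * g x \<partial>M) \<le> (F + 0) powr (1 / a) * (G + 0) powr (1 / b)"
    by (intro tendsto_lowerbound[of _ _ "at_right 0"]) auto
  then show ?thesis by (simp add: F_def G_def)
qed

section \<open>The Hardy remainder\<close>

lemma abs_powr_sgn_mult: "\<bar>x\<bar> powr (a - 1) * sgn x * x = \<bar>x\<bar> powr a" for x :: real
  by (cases "x = 0") (auto simp: powr_diff sgn_if)

lemma test_functionsD:
  assumes "u \<in> test_functions U"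
  obtains K where "C1c u" "compact K" "closed K" "K \<subseteq> U" "\<And>x. x \<notin> K \<Longrightarrow> u x = 0"
proof
  let ?K = "closure {x. u x \<noteq> 0}"
  have 0: "u x = 0" if "x \<notin> ?K" for x
    using that closure_subset[of "{x. u x \<noteq> 0}"] by auto
  show "C1c u" using assms 0 unfolding C1c_def test_functions_def by blast
  show "compact ?K" "closed ?K" "?K \<subseteq> U" using assms by (auto simp: test_functions_def)
  show "u x = 0" if "x \<notin> ?K" for x using 0[OF that] .
qed

lemma integrable_indicator_compact_support:
  fixes F :: "'a::euclidean_space \<Rightarrow> real"
  assumes "compact K" "K \<subseteq> U" "continuous_on U F" "\<And>x. x \<in> U \<Longrightarrow> x \<notin> K \<Longrightarrow> F x = 0"
  shows "integrable lborel (\<lambda>x. indicator U x *\<^sub>R F x)"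
proof (rule integrable_continuous_compact_support[OF assms(1,2)])
  show "continuous_on U (\<lambda>x. indicator U x *\<^sub>R F x)"
    using assms(3) by (rule continuous_on_eq) simp
  show "indicator U x *\<^sub>R F x = 0" if "x \<notin> K" for x
    using that assms by (cases "x \<in> U") auto
qed

lemma integral_lincomb3:
  fixes f1 f2 f3 :: "'a \<Rightarrow> real"
  assumes "integrable M f1" "integrable M f2" "integrable M f3"
  shows "(\<integral>x. a * f1 x + b * f2 x + c * f3 x \<partial>M) = a * (\<integral>x. f1 x \<partial>M) + b * (\<integral>x. f2 x \<partial>M) + c * (\<integral>x. f3 x \<partial>M)"
  using assms by simp

text \<open>The \<open>B\<close> of the overview, with \<open>k\<close> left free because the
  gradient bound for \<open>\<bar>u\<bar> powr q\<close> holds for every positive \<open>k\<close>.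
  Only the Hardy remainder needs \<open>k = (p - 1) / p\<close>.\<close>

definition hardy_rest :: "'n::finite heisenberg \<Rightarrow> real \<Rightarrow> real \<Rightarrow> ('n heisenberg \<Rightarrow> real) \<Rightarrow> 'n heisenberg \<Rightarrow> (real^'n) \<times> (real^'n)" where
  "hardy_rest \<nu> d k u \<xi> = horizontal_gradient u \<xi> - (k * u \<xi> / boundary_dist \<nu> d \<xi>) *\<^sub>R hnormal \<nu> \<xi>"

lemma open_half_space: "open (half_space \<nu> d)"
  unfolding half_space_def using open_halfspace_gt[of d \<nu>] by (simp add: inner_commute)

lemma boundary_dist_pos: "\<xi> \<in> half_space \<nu> d \<Longrightarrow> 0 < boundary_dist \<nu> d \<xi>"
  by (simp add: half_space_def boundary_dist_def)

lemma continuous_on_boundary_dist: "continuous_on S (boundary_dist \<nu> d)"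
  unfolding boundary_dist_def[abs_def] by (intro continuous_intros)

lemma continuous_on_angle_function: "continuous_on S (angle_function \<nu>)"
  unfolding angle_function_eq_norm[abs_def] by (intro continuous_intros)

lemma angle_function_nonneg: "0 \<le> angle_function \<nu> \<xi>"
  by (simp add: angle_function_eq_norm)

lemma hnormal_inner_self: "hnormal \<nu> \<xi> \<bullet> hnormal \<nu> \<xi> = (angle_function \<nu> \<xi>)\<^sup>2"
  by (simp add: angle_function_eq_norm power2_norm_eq_inner)

lemma continuous_on_hardy_rest:
  assumes "C1c u"
  shows "continuous_on (half_space \<nu> d) (hardy_rest \<nu> d k u)"
  unfolding hardy_rest_def[abs_def] using boundary_dist_pos[of _ \<nu> d]
  by (intro continuous_intros continuous_on_horizontal_gradient C1c_continuous_on continuous_on_boundary_dist assms)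
    (force simp: less_le)

lemma hardy_remainder:
  fixes \<nu> :: "'n::finite heisenberg"
  assumes u: "u \<in> test_functions (half_space \<nu> d)" and p: "2 \<le> p"
  shows "2 powr (1 - p) * (LINT \<xi>:half_space \<nu> d|lborel. norm (hardy_rest \<nu> d ((p - 1) / p) u \<xi>) powr p)
    \<le> (LINT \<xi>:half_space \<nu> d|lborel. norm (horizontal_gradient u \<xi>) powr p)
            - ((p - 1) / p) powr p *
              (LINT \<xi>:half_space \<nu> d|lborel.
                 angle_function \<nu> \<xi> powr p / boundary_dist \<nu> d \<xi> powr p * \<bar>u \<xi>\<bar> powr p)"
proof -
  define U where "U = half_space \<nu> d"
  define k where "k = (p - 1) / p"
  define D where "D = boundary_dist \<nu> d"
  define W where "W = angle_function \<nu>"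
  define B where "B = hardy_rest \<nu> d k u"
  obtain K where c1: "C1c u" and K: "compact K" "closed K" "K \<subseteq> U" "\<And>x. x \<notin> K \<Longrightarrow> u x = 0"
    using test_functionsD[OF u] unfolding U_def by metis
  have k0: "0 < k" using p by (simp add: k_def)
  have Dpos: "0 < D \<xi>" if "\<xi> \<in> U" for \<xi> using that boundary_dist_pos by (simp add: D_def U_def)
  have W0: "0 \<le> W \<xi>" for \<xi> by (simp add: W_def angle_function_nonneg)
  have uc: "continuous_on S u" for S by (rule C1c_continuous_on[OF c1])
  have Dc: "continuous_on S D" for S by (simp add: D_def continuous_on_boundary_dist)
  have Wc: "continuous_on S W" for S by (simp add: W_def continuous_on_angle_function)
  have Bc: "continuous_on U B" by (simp add: U_def B_def continuous_on_hardy_rest c1)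
  have Gc: "continuous_on S (horizontal_gradient u)" for S by (rule continuous_on_horizontal_gradient[OF c1])
  have G0: "horizontal_gradient u \<xi> = 0" if "\<xi> \<notin> K" for \<xi>
    by (rule horizontal_gradient_zero_outside[OF K(2,4) that])
  have B0: "B \<xi> = 0" if "\<xi> \<notin> K" for \<xi>
    by (simp add: B_def hardy_rest_def G0[OF that] K(4)[OF that])
  define h where "h \<xi> = \<bar>u \<xi>\<bar> powr p * D \<xi> powr (1 - p)" for \<xi>
  define h' where "h' \<xi> v = \<bar>u \<xi>\<bar> powr p * (((1 - p) * D \<xi> powr (1 - p - 1)) * (v \<bullet> \<nu>))
    + (p * (\<bar>u \<xi>\<bar> powr (p - 1) * sgn (u \<xi>)) * frechet_derivative u (at \<xi>) v) * D \<xi> powr (1 - p)" for \<xi> v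
  have hd: "(h has_derivative h' \<xi>) (at \<xi>)" if "\<xi> \<in> U" for \<xi>
  proof -
    have 1: "((\<lambda>\<xi>. \<bar>u \<xi>\<bar> powr p) has_derivative (\<lambda>v. p * (\<bar>u \<xi>\<bar> powr (p - 1) * sgn (u \<xi>)) * frechet_derivative u (at \<xi>) v)) (at \<xi>)"
      using has_derivative_compose[OF C1c_has_derivative[OF c1, of \<xi>], of "\<lambda>s. \<bar>s\<bar> powr p"] has_real_derivative_abs_powr[of p "u \<xi>"] p
      by (simp add: has_field_derivative_def)
    have "(D has_derivative (\<lambda>v. v \<bullet> \<nu>)) (at \<xi>)"
      unfolding D_def boundary_dist_def[abs_def] by (auto intro!: derivative_eq_intros)
    then have 2: "((\<lambda>\<xi>. D \<xi> powr (1 - p)) has_derivative (\<lambda>v. ((1 - p) * D \<xi> powr (1 - p - 1)) * (v \<bullet> \<nu>))) (at \<xi>)"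
      using has_derivative_compose[of D _ \<xi> UNIV "\<lambda>s. s powr (1 - p)"] has_real_derivative_powr[OF Dpos[OF that], of "1 - p"]
      by (simp add: has_field_derivative_def)
    show ?thesis
      unfolding h_def[abs_def] h'_def[abs_def] by (rule has_derivative_mult[OF 1 2])
  qed
  have hc1: "C1c h"
  proof (rule C1cI[OF K(1) _ _ K(3) hd])
    show "h x = 0" if "x \<notin> K" for x by (simp add: h_def K(4)[OF that])
    show "open U" by (simp add: U_def open_half_space)
    have 1: "continuous_on U (\<lambda>\<xi>. \<bar>u \<xi>\<bar> powr (p - 1) * sgn (u \<xi>))"
      by (rule continuous_on_compose2[OF continuous_on_abs_powr_sgn[of "p - 1" UNIV] uc]) (use p in auto)
    have 2: "continuous_on U (\<lambda>\<xi>. \<bar>u \<xi>\<bar> powr p)"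
      using p by (intro continuous_on_powr_const continuous_on_rabs uc) auto
    have 3: "continuous_on U (\<lambda>\<xi>. D \<xi> powr a)" for a
      using Dpos by (intro continuous_on_powr continuous_on_const Dc) force
    show "continuous_on U (\<lambda>\<xi>. h' \<xi> v)" for v
      unfolding h'_def
      by (rule continuous_on_add[OF
            continuous_on_mult[OF 2 continuous_on_mult[OF continuous_on_mult[OF continuous_on_const 3] continuous_on_const]]
            continuous_on_mult[OF continuous_on_mult[OF continuous_on_mult[OF continuous_on_const 1] C1c_continuous_derivative[OF c1]] 3]])
  qed
  let ?H = "\<lambda>\<xi>. horizontal_gradient h \<xi> \<bullet> hnormal \<nu> \<xi>"
  \<comment> \<open>This lets \<open>?F4\<close> below stand without an indicator, as the vanishing
    integral over the whole space requires.\<close>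
  have H0: "horizontal_gradient h \<xi> = 0" if "\<xi> \<notin> U" for \<xi>
    by (rule horizontal_gradient_zero_outside[OF K(2)]) (use that K in \<open>auto simp: h_def\<close>)
  have Heq: "?H \<xi> = p * (\<bar>u \<xi>\<bar> powr (p - 1) * sgn (u \<xi>)) * D \<xi> powr (1 - p) * (B \<xi> \<bullet> hnormal \<nu> \<xi>)" if "\<xi> \<in> U" for \<xi>
  proof -
    have D: "0 < D \<xi>" using Dpos[OF that] .
    have "?H \<xi> = h' \<xi> (hfield (hnormal \<nu> \<xi>) \<xi>)"
      using frechet_derivative_hfield[OF C1c_differentiable[OF hc1], of \<xi> "hnormal \<nu> \<xi>"]
      by (simp add: frechet_derivative_at[OF hd[OF that], symmetric])
    also have "\<dots> = \<bar>u \<xi>\<bar> powr p * (((1 - p) * D \<xi> powr (1 - p - 1)) * (W \<xi>)\<^sup>2)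
      + (p * (\<bar>u \<xi>\<bar> powr (p - 1) * sgn (u \<xi>)) * (horizontal_gradient u \<xi> \<bullet> hnormal \<nu> \<xi>)) * D \<xi> powr (1 - p)"
      by (simp add: h'_def hfield_inner_normal hnormal_inner_self W_def frechet_derivative_hfield[OF C1c_differentiable[OF c1]])
    also have "horizontal_gradient u \<xi> \<bullet> hnormal \<nu> \<xi> = B \<xi> \<bullet> hnormal \<nu> \<xi> + k * u \<xi> / D \<xi> * (W \<xi>)\<^sup>2"
      by (simp add: B_def hardy_rest_def D_def inner_diff_left hnormal_inner_self W_def)
    also have "(p * (\<bar>u \<xi>\<bar> powr (p - 1) * sgn (u \<xi>)) * (B \<xi> \<bullet> hnormal \<nu> \<xi> + k * u \<xi> / D \<xi> * (W \<xi>)\<^sup>2)) * D \<xi> powr (1 - p)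
       = p * (\<bar>u \<xi>\<bar> powr (p - 1) * sgn (u \<xi>)) * D \<xi> powr (1 - p) * (B \<xi> \<bullet> hnormal \<nu> \<xi>)
       + (p * k) * (\<bar>u \<xi>\<bar> powr (p - 1) * sgn (u \<xi>) * u \<xi>) * (D \<xi> powr (1 - p) / D \<xi>) * (W \<xi>)\<^sup>2"
      by (simp add: algebra_simps)
    also have "D \<xi> powr (1 - p) / D \<xi> = D \<xi> powr (1 - p - 1)"
      using D powr_minus_divide[of "D \<xi>" p] by (simp add: powr_diff)
    \<comment> \<open>The choice of \<open>k\<close>: the term from differentiating
      \<open>D powr (1 - p)\<close> now cancels the part of the gradient of \<open>u\<close> along
      \<open>N\<close>, and only \<open>B\<close> survives.\<close>
    also have "p * k = p - 1" using p by (simp add: k_def)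
    finally show ?thesis unfolding abs_powr_sgn_mult by (simp add: algebra_simps)
  qed
  let ?i = "indicat_real U"
  let ?F1 = "\<lambda>\<xi>. norm (horizontal_gradient u \<xi>) powr p"
  let ?F2 = "\<lambda>\<xi>. W \<xi> powr p / D \<xi> powr p * \<bar>u \<xi>\<bar> powr p"
  let ?F3 = "\<lambda>\<xi>. norm (B \<xi>) powr p"
  let ?F4 = "\<lambda>\<xi>. W \<xi> powr (p - 2) * ?H \<xi>"
  have i1: "integrable lborel (\<lambda>\<xi>. ?i \<xi> *\<^sub>R ?F1 \<xi>)"
    by (rule integrable_indicator_compact_support[OF K(1,3)])
      (use p in \<open>auto intro!: continuous_on_powr_const continuous_on_norm Gc simp: G0\<close>)
  have i2: "integrable lborel (\<lambda>\<xi>. ?i \<xi> *\<^sub>R ?F2 \<xi>)"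
  proof (rule integrable_indicator_compact_support[OF K(1,3)])
    have "D \<xi> powr p \<noteq> 0" if "\<xi> \<in> U" for \<xi> using Dpos[OF that] by simp
    moreover have "continuous_on U (\<lambda>\<xi>. D \<xi> powr p)"
      using Dpos by (intro continuous_on_powr continuous_on_const Dc) force
    moreover have "continuous_on U (\<lambda>\<xi>. W \<xi> powr p)" "continuous_on U (\<lambda>\<xi>. \<bar>u \<xi>\<bar> powr p)"
      using p W0 by (auto intro!: continuous_on_powr_const continuous_on_rabs Wc uc)
    ultimately show "continuous_on U ?F2" by (intro continuous_on_mult continuous_on_divide) auto
  qed (simp add: K(4))
  have i3: "integrable lborel (\<lambda>\<xi>. ?i \<xi> *\<^sub>R ?F3 \<xi>)"
    by (rule integrable_indicator_compact_support[OF K(1,3)])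
      (use p in \<open>auto intro!: continuous_on_powr_const continuous_on_norm Bc simp: B0\<close>)
  have i4: "integrable lborel ?F4" "(\<integral>\<xi>. ?F4 \<xi> \<partial>lborel) = 0"
    using integral_angle_powr_normal_derivative[OF hc1, of "p - 2" \<nu>] p by (simp_all add: W_def)
  have "(\<integral>\<xi>. k powr p * (?i \<xi> *\<^sub>R ?F2 \<xi>) + k powr (p - 1) * ?F4 \<xi> + 2 powr (1 - p) * (?i \<xi> *\<^sub>R ?F3 \<xi>) \<partial>lborel)
    \<le> (\<integral>\<xi>. ?i \<xi> *\<^sub>R ?F1 \<xi> \<partial>lborel)"
  proof (rule integral_mono)
    show "integrable lborel (\<lambda>\<xi>. k powr p * (?i \<xi> *\<^sub>R ?F2 \<xi>) + k powr (p - 1) * ?F4 \<xi> + 2 powr (1 - p) * (?i \<xi> *\<^sub>R ?F3 \<xi>))"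
      by (intro Bochner_Integration.integrable_add integrable_mult_right i2 i3 i4)
    fix \<xi>
    show "k powr p * (?i \<xi> *\<^sub>R ?F2 \<xi>) + k powr (p - 1) * ?F4 \<xi> + 2 powr (1 - p) * (?i \<xi> *\<^sub>R ?F3 \<xi>) \<le> ?i \<xi> *\<^sub>R ?F1 \<xi>"
    proof (cases "\<xi> \<in> U")
      case True
      define a where "a = (k * u \<xi> / D \<xi>) *\<^sub>R hnormal \<nu> \<xi>"
      have D: "0 < D \<xi>" using Dpos[OF True] .
      have aB: "a + B \<xi> = horizontal_gradient u \<xi>" by (simp add: a_def B_def hardy_rest_def D_def)
      have na: "norm a powr r = k powr r * \<bar>u \<xi>\<bar> powr r / D \<xi> powr r * W \<xi> powr r" for r
        using k0 D W0[of \<xi>] by (simp add: a_def abs_mult powr_mult powr_divide W_def angle_function_eq_norm)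
      \<comment> \<open>The linear term of \<open>powr_norm_add_ge\<close> is turned into a constant
        times \<open>?F4\<close>, which integrates to 0.\<close>
      have "p * norm a powr (p - 2) * (a \<bullet> B \<xi>) =
        p * (k powr (p - 2) * k) * (\<bar>u \<xi>\<bar> powr (p - 2) * u \<xi>) / (D \<xi> powr (p - 2) * D \<xi>) * W \<xi> powr (p - 2) * (B \<xi> \<bullet> hnormal \<nu> \<xi>)"
        unfolding na by (simp add: a_def inner_commute)
      also have "k powr (p - 2) * k = k powr (p - 1)" using k0 powr_add[of k "p - 2" 1] by simp
      also have "\<bar>u \<xi>\<bar> powr (p - 2) * u \<xi> = \<bar>u \<xi>\<bar> powr (p - 1) * sgn (u \<xi>)"
      proof (cases "u \<xi> = 0")
        case False
        then have "\<bar>u \<xi>\<bar> powr (p - 1) = \<bar>u \<xi>\<bar> powr (p - 2) * \<bar>u \<xi>\<bar>" using powr_add[of "\<bar>u \<xi>\<bar>" "p - 2" 1] by simp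
        then show ?thesis by (simp add: mult.assoc mult_sgn_abs abs_mult_sgn)
      qed simp
      also have "D \<xi> powr (p - 2) * D \<xi> = D \<xi> powr (p - 1)" using D powr_add[of "D \<xi>" "p - 2" 1] by simp
      also have "p * k powr (p - 1) * (\<bar>u \<xi>\<bar> powr (p - 1) * sgn (u \<xi>)) / D \<xi> powr (p - 1) * W \<xi> powr (p - 2) * (B \<xi> \<bullet> hnormal \<nu> \<xi>)
        = k powr (p - 1) * ?F4 \<xi>"
        unfolding Heq[OF True] using D powr_minus_divide[of "D \<xi>" "p - 1"] by simp
      finally show ?thesis
        using powr_norm_add_ge[OF p, of a "B \<xi>"] True unfolding aB by (simp add: na mult_ac)
    qed (simp add: H0)
  qed (rule i1)
  then have "k powr p * (\<integral>\<xi>. ?i \<xi> *\<^sub>R ?F2 \<xi> \<partial>lborel) + 2 powr (1 - p) * (\<integral>\<xi>. ?i \<xi> *\<^sub>R ?F3 \<xi> \<partial>lborel)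
    \<le> (\<integral>\<xi>. ?i \<xi> *\<^sub>R ?F1 \<xi> \<partial>lborel)"
    unfolding integral_lincomb3[OF i2 i4(1) i3] i4(2) by simp
  then show ?thesis
    by (simp add: set_lebesgue_integral_def U_def k_def D_def W_def B_def)
qed

text \<open>Pointwise, the gradient of \<open>\<bar>u\<bar> powr q\<close> costs \<open>q\<close>
  times the integrands of \<open>Y\<close> and of \<open>k * X\<close>. Testing \<open>Z\<close>
  against \<open>\<bar>u\<bar> powr q\<close> with weight \<open>1 / W\<close> would give that
  \<open>k * X\<close> plus a term bounded by \<open>Y\<close> is 0, hence
  \<open>k * X \<le> Y\<close> and the factor 2. With the regularised weight \<open>r\<close>,
  bounded by \<open>1 / \<eta>\<close>, the loss is \<open>\<eta> * k * V\<close>.\<close>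

lemma gradient_abs_powr_bound:
  fixes \<nu> :: "'n::finite heisenberg"
  assumes u: "u \<in> test_functions (half_space \<nu> d)" and q: "1 < q" and k: "0 < k"
  shows "C1c (\<lambda>\<xi>. \<bar>u \<xi>\<bar> powr q)"
    and "(\<integral>\<xi>. norm (horizontal_gradient (\<lambda>\<xi>. \<bar>u \<xi>\<bar> powr q) \<xi>) \<partial>lborel) \<le>
      2 * q * (\<integral>\<xi>. indicator (half_space \<nu> d) \<xi> * (\<bar>u \<xi>\<bar> powr (q - 1) * norm (hardy_rest \<nu> d k u \<xi>)) \<partial>lborel)"
proof -
  define U where "U = half_space \<nu> d"
  define D where "D = boundary_dist \<nu> d"
  define W where "W = angle_function \<nu>"
  define B where "B = hardy_rest \<nu> d k u"
  obtain K where c1: "C1c u" and K: "compact K" "closed K" "K \<subseteq> U" "\<And>x. x \<notin> K \<Longrightarrow> u x = 0"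
    using test_functionsD[OF u] unfolding U_def by metis
  have Dpos: "0 < D \<xi>" if "\<xi> \<in> U" for \<xi> using that boundary_dist_pos by (simp add: D_def U_def)
  have W0: "0 \<le> W \<xi>" for \<xi> by (simp add: W_def angle_function_nonneg)
  have uc: "continuous_on S u" for S by (rule C1c_continuous_on[OF c1])
  have Dc: "continuous_on S D" for S by (simp add: D_def continuous_on_boundary_dist)
  have Wc: "continuous_on S W" for S by (simp add: W_def continuous_on_angle_function)
  have Bc: "continuous_on U B" by (simp add: U_def B_def continuous_on_hardy_rest c1)
  have uq: "continuous_on S (\<lambda>\<xi>. \<bar>u \<xi>\<bar> powr a)" if "0 < a" for S a
    using that by (intro continuous_on_powr_const continuous_on_rabs uc) auto
  define g where "g \<xi> = \<bar>u \<xi>\<bar> powr q" for \<xi>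
  have \<phi>: "((\<lambda>s. \<bar>s\<bar> powr q) has_real_derivative q * (\<bar>s\<bar> powr (q - 1) * sgn s)) (at s)" for s :: real
    by (rule has_real_derivative_abs_powr[OF q])
  have \<phi>c: "continuous_on UNIV (\<lambda>s::real. q * (\<bar>s\<bar> powr (q - 1) * sgn s))"
    using q by (intro continuous_on_mult continuous_on_const continuous_on_abs_powr_sgn) simp
  have gc1: "C1c g" unfolding g_def[abs_def] using C1c_compose(1)[OF c1 \<phi> \<phi>c] by simp
  then show "C1c (\<lambda>\<xi>. \<bar>u \<xi>\<bar> powr q)" by (simp add: g_def[abs_def])
  define \<sigma> where "\<sigma> \<xi> = \<bar>u \<xi>\<bar> powr (q - 1) * sgn (u \<xi>)" for \<xi>
  have \<sigma>abs: "\<bar>\<sigma> \<xi>\<bar> = \<bar>u \<xi>\<bar> powr (q - 1)" for \<xi>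
    by (simp add: \<sigma>_def abs_mult abs_sgn_eq)
  have \<sigma>u: "\<sigma> \<xi> * u \<xi> = g \<xi>" for \<xi> unfolding \<sigma>_def g_def by (rule abs_powr_sgn_mult)
  have gg: "horizontal_gradient g \<xi> = (q * \<sigma> \<xi>) *\<^sub>R horizontal_gradient u \<xi>" for \<xi>
    unfolding g_def[abs_def] \<sigma>_def using horizontal_gradient_compose[OF c1 \<phi> \<phi>c] by simp
  have gg0: "horizontal_gradient g \<xi> = 0" if "\<xi> \<notin> K" for \<xi>
    by (rule horizontal_gradient_zero_outside[OF K(2) _ that]) (simp add: g_def K(4))
  have Gu: "horizontal_gradient u \<xi> = B \<xi> + (k * u \<xi> / D \<xi>) *\<^sub>R hnormal \<nu> \<xi>" for \<xi>
    by (simp add: B_def hardy_rest_def D_def)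
  let ?i = "indicat_real U"
  define Y where "Y = (\<integral>\<xi>. ?i \<xi> *\<^sub>R (\<bar>u \<xi>\<bar> powr (q - 1) * norm (B \<xi>)) \<partial>lborel)"
  define X where "X = (\<integral>\<xi>. ?i \<xi> *\<^sub>R (g \<xi> * W \<xi> / D \<xi>) \<partial>lborel)"
  define V where "V = (\<integral>\<xi>. ?i \<xi> *\<^sub>R (g \<xi> / D \<xi>) \<partial>lborel)"
  have Dne: "\<forall>\<xi>\<in>U. D \<xi> \<noteq> 0" using Dpos by force
  have gc: "continuous_on S g" for S using q uq by (simp add: g_def[abs_def])
  have gK: "g \<xi> = 0" if "\<xi> \<notin> K" for \<xi> by (simp add: g_def K(4)[OF that])
  have Yi: "integrable lborel (\<lambda>\<xi>. ?i \<xi> *\<^sub>R (\<bar>u \<xi>\<bar> powr (q - 1) * norm (B \<xi>)))"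
    by (rule integrable_indicator_compact_support[OF K(1,3)])
      (use q in \<open>auto intro!: continuous_on_mult continuous_on_norm uq Bc simp: K(4)\<close>)
  have Xi: "integrable lborel (\<lambda>\<xi>. ?i \<xi> *\<^sub>R (g \<xi> * W \<xi> / D \<xi>))"
    by (rule integrable_indicator_compact_support[OF K(1,3)])
      (use Dne in \<open>auto intro!: continuous_on_mult continuous_on_divide gc Wc Dc simp: gK\<close>)
  have Vi: "integrable lborel (\<lambda>\<xi>. ?i \<xi> *\<^sub>R (g \<xi> / D \<xi>))"
    by (rule integrable_indicator_compact_support[OF K(1,3)])
      (use Dne in \<open>auto intro!: continuous_on_divide gc Dc simp: gK\<close>)
  have V0: "0 \<le> V" unfolding V_def
    by (intro Bochner_Integration.integral_nonneg) (use Dpos in \<open>auto simp: g_def indicator_def less_imp_le\<close>)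
  have XY: "k * X \<le> Y + \<eta> * (k * V)" if \<eta>: "0 < \<eta>" for \<eta>
  proof -
    define r where "r \<xi> = ((W \<xi>)\<^sup>2 + \<eta>\<^sup>2) powr (- (1/2))" for \<xi>
    let ?Z = "\<lambda>\<xi>. r \<xi> * (horizontal_gradient g \<xi> \<bullet> hnormal \<nu> \<xi>)"
    have pos: "0 < (W \<xi>)\<^sup>2 + \<eta>\<^sup>2" for \<xi> using \<eta> by (simp add: add_nonneg_pos)
    have Zi: "integrable lborel ?Z"
    proof (rule integrable_continuous_compact_support[OF K(1)])
      have "continuous_on UNIV r" unfolding r_def[abs_def]
        using less_imp_neq[OF pos] by (intro continuous_on_powr continuous_on_add continuous_on_power continuous_on_const Wc) auto
      then show "continuous_on UNIV ?Z"
        by (intro continuous_on_mult continuous_on_inner continuous_on_hnormal continuous_on_id continuous_on_horizontal_gradient gc1)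
    qed (simp_all add: gg0)
    have Z0: "(\<integral>\<xi>. ?Z \<xi> \<partial>lborel) = 0"
      unfolding r_def W_def by (rule integral_angle_eps_normal_derivative[OF gc1]) (use \<eta> in simp)
    have "(\<integral>\<xi>. k * (?i \<xi> *\<^sub>R (g \<xi> * W \<xi> / D \<xi>)) \<partial>lborel)
      \<le> (\<integral>\<xi>. (1 / q) * ?Z \<xi> + 1 * (?i \<xi> *\<^sub>R (\<bar>u \<xi>\<bar> powr (q - 1) * norm (B \<xi>))) + \<eta> * k * (?i \<xi> *\<^sub>R (g \<xi> / D \<xi>)) \<partial>lborel)"
    proof (rule integral_mono)
      show "integrable lborel (\<lambda>\<xi>. k * (?i \<xi> *\<^sub>R (g \<xi> * W \<xi> / D \<xi>)))"
        by (rule integrable_mult_right) (rule Xi)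
      show "integrable lborel (\<lambda>\<xi>. (1 / q) * ?Z \<xi> + 1 * (?i \<xi> *\<^sub>R (\<bar>u \<xi>\<bar> powr (q - 1) * norm (B \<xi>))) + \<eta> * k * (?i \<xi> *\<^sub>R (g \<xi> / D \<xi>)))"
        by (intro Bochner_Integration.integrable_add integrable_mult_right Zi Yi Vi)
      fix \<xi>
      show "k * (?i \<xi> *\<^sub>R (g \<xi> * W \<xi> / D \<xi>)) \<le>
        (1 / q) * ?Z \<xi> + 1 * (?i \<xi> *\<^sub>R (\<bar>u \<xi>\<bar> powr (q - 1) * norm (B \<xi>))) + \<eta> * k * (?i \<xi> *\<^sub>R (g \<xi> / D \<xi>))"
      proof (cases "\<xi> \<in> U")
        case True
        have D: "0 < D \<xi>" using Dpos[OF True] .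
        define s where "s = sqrt ((W \<xi>)\<^sup>2 + \<eta>\<^sup>2)"
        have s: "0 < s" "s\<^sup>2 = (W \<xi>)\<^sup>2 + \<eta>\<^sup>2" "W \<xi> \<le> s" "\<eta> \<le> s" using pos[of \<xi>] \<eta> W0[of \<xi>]
          by (auto simp: s_def real_le_rsqrt)
        have rs: "r \<xi> = 1 / s" using pos[of \<xi>]
          by (simp add: r_def s_def powr_minus_divide powr_half_sqrt)
        \<comment> \<open>Divided by \<open>s\<close>, this says that replacing \<open>1 / W\<close>
          by \<open>r = 1 / s\<close> loses at most \<open>\<eta>\<close>. It rests on
          \<open>s\<^sup>2 - (W \<xi>)\<^sup>2 = \<eta>\<^sup>2\<close> and
          \<open>\<eta> \<le> s\<close>.\<close>
        have "W \<xi> * s \<le> (W \<xi>)\<^sup>2 + \<eta> * s"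
        proof -
          have "W \<xi> * (s - W \<xi>) \<le> (s + W \<xi>) * (s - W \<xi>)"
            using s by (intro mult_right_mono) auto
          also have "\<dots> = \<eta> * \<eta>" using s(2) by (simp add: algebra_simps power2_eq_square)
          also have "\<dots> \<le> \<eta> * s" using s(4) \<eta> by (intro mult_left_mono) auto
          finally show ?thesis by (simp add: algebra_simps power2_eq_square)
        qed
        then have w1: "W \<xi> - \<eta> \<le> r \<xi> * (W \<xi>)\<^sup>2" using s by (simp add: rs field_simps)
        have w2: "0 \<le> r \<xi>" "r \<xi> * W \<xi> \<le> 1" using s by (simp_all add: rs)
        have "\<bar>r \<xi> * (\<sigma> \<xi> * (B \<xi> \<bullet> hnormal \<nu> \<xi>))\<bar> \<le> r \<xi> * (\<bar>u \<xi>\<bar> powr (q - 1) * (norm (B \<xi>) * W \<xi>))"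
          using w2(1) Cauchy_Schwarz_ineq2[of "B \<xi>" "hnormal \<nu> \<xi>"]
          by (simp add: abs_mult \<sigma>abs W_def angle_function_eq_norm mult_left_mono)
        also have "\<dots> = (r \<xi> * W \<xi>) * (\<bar>u \<xi>\<bar> powr (q - 1) * norm (B \<xi>))" by simp
        also have "\<dots> \<le> 1 * (\<bar>u \<xi>\<bar> powr (q - 1) * norm (B \<xi>))" using w2 by (intro mult_right_mono) auto
        finally have b: "- (\<bar>u \<xi>\<bar> powr (q - 1) * norm (B \<xi>)) \<le> r \<xi> * (\<sigma> \<xi> * (B \<xi> \<bullet> hnormal \<nu> \<xi>))" by linarith
        have eq: "(1 / q) * ?Z \<xi> = r \<xi> * (\<sigma> \<xi> * (B \<xi> \<bullet> hnormal \<nu> \<xi>)) + k * (\<sigma> \<xi> * u \<xi>) / D \<xi> * (r \<xi> * (W \<xi>)\<^sup>2)"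
          using q by (simp add: gg Gu inner_add_left hnormal_inner_self W_def algebra_simps)
        have "k * g \<xi> / D \<xi> * (W \<xi> - \<eta>) \<le> k * g \<xi> / D \<xi> * (r \<xi> * (W \<xi>)\<^sup>2)"
          using w1 k D by (intro mult_left_mono) (auto simp: g_def)
        then have "k * g \<xi> / D \<xi> * (W \<xi> - \<eta>) \<le> (1 / q) * ?Z \<xi> + \<bar>u \<xi>\<bar> powr (q - 1) * norm (B \<xi>)"
          using b unfolding eq \<sigma>u by linarith
        moreover have "k * g \<xi> / D \<xi> * (W \<xi> - \<eta>) = k * (g \<xi> * W \<xi> / D \<xi>) - \<eta> * k * (g \<xi> / D \<xi>)"
          by (simp add: algebra_simps diff_divide_distrib)
        ultimately show ?thesis using True by simp
      next
        case False
        then have "horizontal_gradient g \<xi> = 0" using K(3) gg0 by blast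
        then show ?thesis using False by simp
      qed
    qed
    also have "\<dots> = Y + \<eta> * k * V"
      unfolding integral_lincomb3[OF Zi Yi Vi] Z0 by (simp add: Y_def V_def)
    finally show ?thesis by (simp only: integral_mult_right_zero X_def mult.assoc)
  qed
  \<comment> \<open>\<open>V\<close> does not depend on \<open>\<eta>\<close>, so the error vanishes
    with \<open>\<eta>\<close>; the \<open>+ 1\<close> in the denominator covers
    \<open>V = 0\<close>.\<close>
  have "k * X \<le> Y"
  proof (rule field_le_epsilon)
    fix e :: real assume e: "0 < e"
    have kV: "0 \<le> k * V" using k V0 by simp
    have "k * X \<le> Y + e / (k * V + 1) * (k * V)" using XY[of "e / (k * V + 1)"] e kV by simp
    also have "e / (k * V + 1) * (k * V) \<le> e" using e kV by (simp add: field_simps)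
    finally show "k * X \<le> Y + e" by simp
  qed
  have "(\<integral>\<xi>. norm (horizontal_gradient g \<xi>) \<partial>lborel)
    \<le> (\<integral>\<xi>. q * (?i \<xi> *\<^sub>R (\<bar>u \<xi>\<bar> powr (q - 1) * norm (B \<xi>))) + q * k * (?i \<xi> *\<^sub>R (g \<xi> * W \<xi> / D \<xi>)) \<partial>lborel)"
  proof (rule integral_mono)
    show "integrable lborel (\<lambda>\<xi>. norm (horizontal_gradient g \<xi>))"
      by (rule C1c_integrable_horizontal_gradient[OF gc1])
    show "integrable lborel (\<lambda>\<xi>. q * (?i \<xi> *\<^sub>R (\<bar>u \<xi>\<bar> powr (q - 1) * norm (B \<xi>))) + q * k * (?i \<xi> *\<^sub>R (g \<xi> * W \<xi> / D \<xi>)))"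
      by (intro Bochner_Integration.integrable_add integrable_mult_right Yi Xi)
    fix \<xi>
    show "norm (horizontal_gradient g \<xi>) \<le> q * (?i \<xi> *\<^sub>R (\<bar>u \<xi>\<bar> powr (q - 1) * norm (B \<xi>))) + q * k * (?i \<xi> *\<^sub>R (g \<xi> * W \<xi> / D \<xi>))"
    proof (cases "\<xi> \<in> U")
      case True
      have D: "0 < D \<xi>" using Dpos[OF True] .
      have gs: "g \<xi> = \<bar>\<sigma> \<xi>\<bar> * \<bar>u \<xi>\<bar>" using \<sigma>u[of \<xi>] by (metis abs_mult abs_of_nonneg g_def powr_ge_zero)
      have "norm (horizontal_gradient u \<xi>) \<le> norm (B \<xi>) + k * \<bar>u \<xi>\<bar> / D \<xi> * W \<xi>"
        unfolding Gu using norm_triangle_ineq[of "B \<xi>" "(k * u \<xi> / D \<xi>) *\<^sub>R hnormal \<nu> \<xi>"] k D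
        by (simp add: abs_mult W_def angle_function_eq_norm)
      then have "q * \<bar>\<sigma> \<xi>\<bar> * norm (horizontal_gradient u \<xi>) \<le> q * \<bar>\<sigma> \<xi>\<bar> * (norm (B \<xi>) + k * \<bar>u \<xi>\<bar> / D \<xi> * W \<xi>)"
        using q by (intro mult_left_mono) auto
      also have "\<dots> = q * (\<bar>\<sigma> \<xi>\<bar> * norm (B \<xi>)) + q * k * (g \<xi> * W \<xi> / D \<xi>)"
        unfolding gs by (simp add: algebra_simps)
      finally show ?thesis using True q by (simp add: gg abs_mult \<sigma>abs)
    next
      case False
      then have "horizontal_gradient g \<xi> = 0" using K(3) gg0 by blast
      then show ?thesis using False by simp
    qed
  qed
  also have "\<dots> = q * Y + q * k * X"
    unfolding Y_def X_def using integral_lincomb3[OF Yi Xi Xi, of q "q * k" 0]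
    by (simp only: mult_zero_left add_0_right)
  also have "\<dots> \<le> 2 * q * Y" using mult_left_mono[OF \<open>k * X \<le> Y\<close>, of q] q by (simp add: mult.assoc)
  finally show "(\<integral>\<xi>. norm (horizontal_gradient (\<lambda>\<xi>. \<bar>u \<xi>\<bar> powr q) \<xi>) \<partial>lborel) \<le>
      2 * q * (\<integral>\<xi>. indicator (half_space \<nu> d) \<xi> * (\<bar>u \<xi>\<bar> powr (q - 1) * norm (hardy_rest \<nu> d k u \<xi>)) \<partial>lborel)"
    by (simp add: g_def[abs_def] Y_def U_def B_def)
qed

text \<open>The conjunct \<open>0 \<le> \<Delta>\<close> makes the real \<open>p\<close>-th root
  meaningful: \<open>powr\<close> is positive at negative arguments too, so the lower bound alone
  would not exclude a negative difference.\<close>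

theorem theorem3p2:
  fixes \<nu> :: "'n::finite heisenberg" and d p Q pstar :: real
  assumes "norm \<nu> = 1"
    and "Q = 2 * real CARD('n) + 2"
    and "2 \<le> p" and "p < Q"
    and "pstar = Q * p / (Q - p)"
  shows "\<exists>C>0. \<forall>u\<in>test_functions (half_space \<nu> d).
    (let \<Delta> = (LINT \<xi>:half_space \<nu> d|lborel. norm (horizontal_gradient u \<xi>) powr p)
            - ((p - 1) / p) powr p *
              (LINT \<xi>:half_space \<nu> d|lborel.
                 angle_function \<nu> \<xi> powr p / boundary_dist \<nu> d \<xi> powr p * \<bar>u \<xi>\<bar> powr p)
     in 0 \<le> \<Delta> \<and>
        \<Delta> powr (1 / p) \<ge> C * (LINT \<xi>:half_space \<nu> d|lborel. \<bar>u \<xi>\<bar> powr pstar) powr (1 / pstar))"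
proof -
  note Q = assms(2) and p = assms(3,4) and ps = assms(5)
  define k where "k = (p - 1) / p"
  \<comment> \<open>The exponent for which the Sobolev power of \<open>\<bar>u\<bar> powr q\<close>
    and the Hoelder power of \<open>\<bar>u\<bar> powr (q - 1)\<close> are both
    \<open>\<bar>u\<bar> powr pstar\<close>; these are \<open>e1\<close> and
    \<open>e2\<close>.\<close>
  define q where "q = p * (Q - 1) / (Q - p)"
  have k: "0 < k" using p by (simp add: k_def)
  have Q2: "2 < Q" using p by linarith
  have q: "1 < q"
  proof -
    have "0 < (p - 1) * Q" using p Q2 by (intro mult_pos_pos) auto
    then show ?thesis using p by (simp add: q_def field_simps)
  qed
  have ps0: "0 < pstar" using p Q2 by (simp add: ps)
  have e1: "q * (Q / (Q - 1)) = pstar"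
  proof -
    have "q * (Q / (Q - 1)) = Q * p / (Q - p) * ((Q - 1) / (Q - 1))" by (simp add: q_def)
    then show ?thesis using Q2 by (simp add: ps)
  qed
  have e2: "(q - 1) * (p / (p - 1)) = pstar"
  proof -
    have "q - 1 = Q * (p - 1) / (Q - p)" using p by (simp add: q_def field_simps)
    then have "(q - 1) * (p / (p - 1)) = Q * p / (Q - p) * ((p - 1) / (p - 1))" by simp
    then show ?thesis using p by (simp add: ps)
  qed
  \<comment> \<open>After Hoelder the integral \<open>T\<close> stands on both sides. Dividing by
    \<open>T powr ((p - 1) / p)\<close> leaves exactly the exponent
    \<open>1 / pstar\<close>.\<close>
  have e3: "(Q - 1) / Q = 1 / pstar + (p - 1) / p"
  proof -
    have "1 / pstar = (Q - p) / (Q * p)" by (simp add: ps)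
    then show ?thesis using p Q2 by (simp add: field_simps)
  qed
  obtain C0 where C0: "0 < C0" and sob: "\<And>g :: 'n heisenberg \<Rightarrow> real. C1c g \<Longrightarrow> (\<And>x. 0 \<le> g x) \<Longrightarrow>
      (\<integral>x. g x powr (Q / (Q - 1)) \<partial>lborel) powr ((Q - 1) / Q) \<le> C0 * (\<integral>x. norm (horizontal_gradient g x) \<partial>lborel)"
  proof -
    have Q1: "2 * real CARD('n) + 1 = Q - 1" using Q by simp
    show thesis using sobolev_L1[where 'n = 'n, unfolded Q[symmetric] Q1] that by blast
  qed
  \<comment> \<open>\<open>C0\<close> is the Sobolev constant, \<open>2 * q\<close> comes from the
    gradient bound, and the last factor is the \<open>p\<close>-th root of
    \<open>2 powr (p - 1)\<close>, which undoes the constant of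
    \<open>hardy_remainder\<close>.\<close>
  define A where "A = C0 * (2 * q) * 2 powr ((p - 1) / p)"
  have A: "0 < A" using C0 q by (simp add: A_def)
  have main: "0 \<le> \<Delta> \<and> 1 / A * (LINT \<xi>:half_space \<nu> d|lborel. \<bar>u \<xi>\<bar> powr pstar) powr (1 / pstar) \<le> \<Delta> powr (1 / p)"
    if u: "u \<in> test_functions (half_space \<nu> d)"
      and \<Delta>: "\<Delta> = (LINT \<xi>:half_space \<nu> d|lborel. norm (horizontal_gradient u \<xi>) powr p)
            - ((p - 1) / p) powr p *
              (LINT \<xi>:half_space \<nu> d|lborel.
                 angle_function \<nu> \<xi> powr p / boundary_dist \<nu> d \<xi> powr p * \<bar>u \<xi>\<bar> powr p)" for u \<Delta>
  proof -
    define U where "U = half_space \<nu> d"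
    obtain K where c1: "C1c u" and K: "compact K" "closed K" "K \<subseteq> U" "\<And>x. x \<notin> K \<Longrightarrow> u x = 0"
      using test_functionsD[OF u] unfolding U_def by metis
    let ?i = "indicat_real U"
    define B where "B = hardy_rest \<nu> d k u"
    define T where "T = (\<integral>\<xi>. \<bar>u \<xi>\<bar> powr pstar \<partial>lborel)"
    define R where "R = (\<integral>\<xi>. ?i \<xi> *\<^sub>R (norm (B \<xi>) powr p) \<partial>lborel)"
    have T0: "0 \<le> T" and R0: "0 \<le> R" by (simp_all add: T_def R_def)
    have Bc: "continuous_on U B" by (simp add: U_def B_def continuous_on_hardy_rest c1)
    have B0: "B \<xi> = 0" if "\<xi> \<notin> K" for \<xi>
      using horizontal_gradient_zero_outside[OF K(2,4) that] by (simp add: B_def hardy_rest_def K(4)[OF that])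
    have Teq: "(LINT \<xi>:half_space \<nu> d|lborel. \<bar>u \<xi>\<bar> powr pstar) = T"
    proof -
      have "?i \<xi> *\<^sub>R \<bar>u \<xi>\<bar> powr pstar = \<bar>u \<xi>\<bar> powr pstar" for \<xi>
        using K(3) K(4)[of \<xi>] by (cases "\<xi> \<in> K") (auto simp: indicator_def)
      then show ?thesis by (simp only: set_lebesgue_integral_def T_def U_def[symmetric])
    qed
    have R\<Delta>: "2 powr (1 - p) * R \<le> \<Delta>"
      using hardy_remainder[OF u p(1)] by (simp add: \<Delta> R_def B_def k_def U_def set_lebesgue_integral_def)
    then have \<Delta>0: "0 \<le> \<Delta>" using R0 by (meson mult_nonneg_nonneg order_trans powr_ge_zero)
    have uq: "continuous_on S (\<lambda>\<xi>. \<bar>u \<xi>\<bar> powr a)" if "0 < a" for S a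
      using that by (intro continuous_on_powr_const continuous_on_rabs C1c_continuous_on c1) auto
    have "T powr ((Q - 1) / Q) = (\<integral>\<xi>. (\<bar>u \<xi>\<bar> powr q) powr (Q / (Q - 1)) \<partial>lborel) powr ((Q - 1) / Q)"
      by (simp only: powr_powr e1 T_def)
    also have "\<dots> \<le> C0 * (\<integral>\<xi>. norm (horizontal_gradient (\<lambda>\<xi>. \<bar>u \<xi>\<bar> powr q) \<xi>) \<partial>lborel)"
      by (rule sob[OF gradient_abs_powr_bound(1)[OF u q k]]) simp
    also have "\<dots> \<le> C0 * (2 * q * (\<integral>\<xi>. \<bar>u \<xi>\<bar> powr (q - 1) * (?i \<xi> * norm (B \<xi>)) \<partial>lborel))"
      using gradient_abs_powr_bound(2)[OF u q k] C0 by (intro mult_left_mono) (auto simp: U_def B_def mult_ac)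
    also have "\<dots> \<le> C0 * (2 * q * (T powr ((p - 1) / p) * R powr (1 / p)))"
    proof -
      have fa: "(\<bar>u \<xi>\<bar> powr (q - 1)) powr (p / (p - 1)) = \<bar>u \<xi>\<bar> powr pstar" for \<xi>
        by (simp only: powr_powr e2)
      have gb: "(?i \<xi> * norm (B \<xi>)) powr p = ?i \<xi> *\<^sub>R (norm (B \<xi>) powr p)" for \<xi>
        by (simp add: indicator_def)
      have "(\<integral>\<xi>. \<bar>u \<xi>\<bar> powr (q - 1) * (?i \<xi> * norm (B \<xi>)) \<partial>lborel) \<le>
        (\<integral>\<xi>. (\<bar>u \<xi>\<bar> powr (q - 1)) powr (p / (p - 1)) \<partial>lborel) powr (1 / (p / (p - 1))) *
        (\<integral>\<xi>. (?i \<xi> * norm (B \<xi>)) powr p \<partial>lborel) powr (1 / p)"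
      proof (rule Holder_inequality_powr)
        show "1 < p / (p - 1)" "1 < p" "1 / (p / (p - 1)) + 1 / p = 1" using p by (auto simp: field_simps)
        show "integrable lborel (\<lambda>\<xi>. (\<bar>u \<xi>\<bar> powr (q - 1)) powr (p / (p - 1)))"
          unfolding fa using ps0
          by (intro integrable_continuous_compact_support[OF K(1) subset_UNIV uq]) (auto simp: K(4))
        show "integrable lborel (\<lambda>\<xi>. (?i \<xi> * norm (B \<xi>)) powr p)"
          unfolding gb using p
          by (intro integrable_indicator_compact_support[OF K(1,3)] continuous_on_powr_const continuous_on_norm Bc) (auto simp: B0)
        have "integrable lborel (\<lambda>\<xi>. ?i \<xi> *\<^sub>R (\<bar>u \<xi>\<bar> powr (q - 1) * norm (B \<xi>)))"
          using q by (intro integrable_indicator_compact_support[OF K(1,3)] continuous_on_mult uq continuous_on_norm Bc) (auto simp: B0)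
        then show "integrable lborel (\<lambda>\<xi>. \<bar>u \<xi>\<bar> powr (q - 1) * (?i \<xi> * norm (B \<xi>)))"
          by (simp add: mult_ac)
      qed auto
      then have "(\<integral>\<xi>. \<bar>u \<xi>\<bar> powr (q - 1) * (?i \<xi> * norm (B \<xi>)) \<partial>lborel) \<le> T powr ((p - 1) / p) * R powr (1 / p)"
        unfolding fa gb by (simp add: T_def R_def)
      then show ?thesis using C0 q by (intro mult_left_mono) auto
    qed
    also have "\<dots> \<le> C0 * (2 * q * (T powr ((p - 1) / p) * (2 powr ((p - 1) / p) * \<Delta> powr (1 / p))))"
    proof -
      have "R \<le> 2 powr (p - 1) * \<Delta>"
        using mult_left_mono[OF R\<Delta>, of "2 powr (p - 1)"] by (simp add: mult.assoc[symmetric] powr_add[symmetric])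
      then have "R powr (1 / p) \<le> (2 powr (p - 1) * \<Delta>) powr (1 / p)"
        using R0 p by (intro powr_mono2) auto
      also have "\<dots> = 2 powr ((p - 1) / p) * \<Delta> powr (1 / p)" using \<Delta>0 by (simp add: powr_mult powr_powr)
      finally show ?thesis using C0 q by (intro mult_left_mono) auto
    qed
    finally have fin: "T powr (1 / pstar) * T powr ((p - 1) / p) \<le> A * \<Delta> powr (1 / p) * T powr ((p - 1) / p)"
      unfolding e3 powr_add by (simp add: A_def mult_ac)
    \<comment> \<open>The common factor can be cancelled only for \<open>T \<noteq> 0\<close>; for
      \<open>T = 0\<close> the left side is 0.\<close>
    have "T powr (1 / pstar) \<le> A * \<Delta> powr (1 / p)"
    proof (cases "T = 0")
      case False
      then have "0 < T powr ((p - 1) / p)" by simp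
      with fin show ?thesis by (rule mult_right_le_imp_le)
    qed (use A in simp)
    then show ?thesis using A \<Delta>0 unfolding Teq by (simp add: field_simps)
  qed
  show ?thesis unfolding Let_def using A main by (intro exI[of _ "1 / A"]) (simp only: divide_pos_pos zero_less_one, blast)
qed

end
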